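(* For every integer $n \geq 3$, $$R^{cl}(\omega+n,3) \;\leq\; \omega^2 \cdot n + \omega \cdot (n^2-4)+1 .$$
   Context: All arithmetic is ordinal arithmetic (with $n^2-4$ the usual natural number). For a set $X$ and $k\in\omega$, $[X]^k=\{Y\subseteq X: |Y|=k\}$. Given ordinals $\beta,\gamma$ and $X\subseteq\gamma$, $X$ is order-homeomorphic to $\beta$ if there is an order-isomorphism $f:X\to\beta$ which is also a homeomorphism, where $\beta$ carries the order topology and $X$ carries the subspace topology inherited from the order topology of $\gamma$. For ordinals $\alpha,\beta,\gamma$, write $\gamma\rightarrow(\alpha,\beta)^2$ if for every function $\mathfrak{c}:[\gamma]^2\to\{0,1\}$ there is $X\subseteq\gamma$ such that either $[X]^2\subseteq\mathfrak{c}^{-1}(0)$ and $X$ is order-homeomorphic to $\alpha$, or $[X]^2\subseteq\mathfrak{c}^{-1}(1)$ and $X$ is order-homeomorphic to $\beta$. The closed Ramsey number $R^{cl}(\alpha,\beta)$ is the least ordinal $\gamma$ with $\gamma\rightarrow(\alpha,\beta)^2$, should such an ordinal exist. *)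

theory Defs
  imports "HOL-Analysis.Analysis" "HOL-Library.Ramsey"
begin

unbundle cardinal_syntax

text \<open>
  Ordinals are represented by well-order relations, with \<^const>\<open>ordIso\<close> as equality of
  ordinals and \<open>\<le>o\<close> as their order; \<^const>\<open>natLeq\<close> is \<open>\<omega>\<close>, and \<open>natLeq_on n\<close> is the
  finite ordinal \<open>n\<close>.
\<close>

fun osum_le :: "'a rel \<Rightarrow> 'b rel \<Rightarrow> 'a + 'b \<Rightarrow> 'a + 'b \<Rightarrow> bool" where
  "osum_le r s (Inl x) (Inl y) \<longleftrightarrow> (x, y) \<in> r"
| "osum_le r s (Inr x) (Inr y) \<longleftrightarrow> (x, y) \<in> s"
| "osum_le r s (Inl x) (Inr y) \<longleftrightarrow> x \<in> Field r \<and> y \<in> Field s"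
| "osum_le r s (Inr x) (Inl y) \<longleftrightarrow> False"

definition osum :: "'a rel \<Rightarrow> 'b rel \<Rightarrow> ('a + 'b) rel"  (infixl \<open>+\<^sub>o\<close> 65)
  where "r +\<^sub>o s = {(u, v). osum_le r s u v}"

text \<open>The ordinal product \<open>r \<cdot> s\<close> is \<open>s\<close> copies of \<open>r\<close>: the second coordinate is compared first.\<close>

definition oprod :: "'a rel \<Rightarrow> 'b rel \<Rightarrow> ('a \<times> 'b) rel"  (infixl \<open>*\<^sub>o\<close> 70)
  where "r *\<^sub>o s = {((x, i), (y, j)). x \<in> Field r \<and> y \<in> Field r \<and> i \<in> Field s \<and> j \<in> Field s \<and>
                                     (i \<noteq> j \<and> (i, j) \<in> s \<or> i = j \<and> (x, y) \<in> r)}"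

text \<open>The whole field is added to the subbase of open rays because a one-point order has only
  empty rays.\<close>

definition rel_order_topology :: "'a rel \<Rightarrow> 'a topology"
  where "rel_order_topology r =
    topology_generated_by (insert (Field r) (underS r ` Field r \<union> aboveS r ` Field r))"

definition order_homeomorphic :: "'c rel \<Rightarrow> 'c set \<Rightarrow> 'a rel \<Rightarrow> bool"
  where "order_homeomorphic \<gamma> X \<beta> \<longleftrightarrow>
    (\<exists>f. iso (Restr \<gamma> X) \<beta> f \<and>
         homeomorphic_map (subtopology (rel_order_topology \<gamma>) X) (rel_order_topology \<beta>) f)"

definition closed_arrow :: "'c rel \<Rightarrow> 'a rel \<Rightarrow> 'b rel \<Rightarrow> bool"
  where "closed_arrow \<gamma> \<alpha> \<beta> \<longleftrightarrow>
    (\<forall>c \<in> [Field \<gamma>]\<^bsup>2\<^esup> \<rightarrow> {0, 1::nat}. \<exists>X \<subseteq> Field \<gamma>.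
       [X]\<^bsup>2\<^esup> \<subseteq> c -` {0} \<and> order_homeomorphic \<gamma> X \<alpha> \<or>
       [X]\<^bsup>2\<^esup> \<subseteq> c -` {1} \<and> order_homeomorphic \<gamma> X \<beta>)"

text \<open>
  \<open>is_closed_ramsey_number \<alpha> \<beta> \<gamma>\<close> says that the closed Ramsey number of \<open>\<alpha>\<close> and \<open>\<beta>\<close> exists
  and equals \<open>\<gamma>\<close>.  The minimality clause can only quantify over well-orders on one type, but all
  ordinals below \<open>\<gamma>\<close> occur among the well-orders on the type of \<open>\<gamma>\<close>, so \<open>\<gamma>\<close> is the least among
  all ordinals: see \<open>is_closed_ramsey_number_least\<close> below.
\<close>

definition is_closed_ramsey_number :: "'a rel \<Rightarrow> 'b rel \<Rightarrow> 'c rel \<Rightarrow> bool"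
  where "is_closed_ramsey_number \<alpha> \<beta> \<gamma> \<longleftrightarrow>
    Well_order \<gamma> \<and> closed_arrow \<gamma> \<alpha> \<beta> \<and>
    (\<forall>\<gamma>' :: 'c rel. Well_order \<gamma>' \<and> closed_arrow \<gamma>' \<alpha> \<beta> \<longrightarrow> \<gamma> \<le>o \<gamma>')"

lemma topspace_rel_order_topology [simp]: "topspace (rel_order_topology r) = Field r"
  unfolding rel_order_topology_def by (auto simp: underS_def aboveS_def Field_def)

lemma iso_continuous_map:
  assumes f: "iso r s f" and r: "Well_order r" and s: "Well_order s"
  shows "continuous_map (rel_order_topology r) (rel_order_topology s) f"
  unfolding rel_order_topology_def[of s]
proof (rule continuous_on_generated_topo)
  have bij: "bij_betw f (Field r) (Field s)"
    and le: "\<And>a b. a \<in> Field r \<Longrightarrow> b \<in> Field r \<Longrightarrow> (a, b) \<in> r \<longleftrightarrow> (f a, f b) \<in> s"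
    using f by (auto simp: iso_iff2)
  show "f ` topspace (rel_order_topology r) \<subseteq>
      \<Union> (insert (Field s) (underS s ` Field s \<union> aboveS s ` Field s))"
    using bij by (auto simp: bij_betw_def)
  fix U assume "U \<in> insert (Field s) (underS s ` Field s \<union> aboveS s ` Field s)"
  then consider "U = Field s" | b where "b \<in> Field s" "U = underS s b"
    | b where "b \<in> Field s" "U = aboveS s b" by auto
  then have "f -` U \<inter> Field r \<in> insert (Field r) (underS r ` Field r \<union> aboveS r ` Field r)"
  proof cases
    case 1
    then have "f -` U \<inter> Field r = Field r" using bij by (auto simp: bij_betw_def)
    then show ?thesis by simp
  next
    case 2
    then obtain a where a: "a \<in> Field r" "f a = b"
      using bij by (metis bij_betw_imp_surj_on imageE)
    have "f -` U \<inter> Field r = underS r a"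
    proof (rule set_eqI)
      fix x
      show "x \<in> f -` U \<inter> Field r \<longleftrightarrow> x \<in> underS r a"
      proof (cases "x \<in> Field r")
        case True
        then have "f x = b \<longleftrightarrow> x = a" using a bij by (auto simp: bij_betw_def inj_on_def)
        moreover have "(x, a) \<in> r \<longleftrightarrow> (f x, b) \<in> s" using le True a by simp
        ultimately show ?thesis using True 2(2) by (simp add: underS_def)
      next
        case False
        then have "\<not> (x, a) \<in> r" using FieldI1 by metis
        then show ?thesis using False by (simp add: underS_def)
      qed
    qed
    then show ?thesis using a by simp
  next
    case 3
    then obtain a where a: "a \<in> Field r" "f a = b"
      using bij by (metis bij_betw_imp_surj_on imageE)
    have "f -` U \<inter> Field r = aboveS r a"
    proof (rule set_eqI)
      fix x
      show "x \<in> f -` U \<inter> Field r \<longleftrightarrow> x \<in> aboveS r a"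
      proof (cases "x \<in> Field r")
        case True
        then have "f x = b \<longleftrightarrow> x = a" using a bij by (auto simp: bij_betw_def inj_on_def)
        moreover have "(a, x) \<in> r \<longleftrightarrow> (b, f x) \<in> s" using le True a by simp
        ultimately show ?thesis using True 3(2) by (simp add: aboveS_def)
      next
        case False
        then have "\<not> (a, x) \<in> r" using FieldI2 by metis
        then show ?thesis using False by (simp add: aboveS_def)
      qed
    qed
    then show ?thesis using a by simp
  qed
  then show "openin (rel_order_topology r) (f -` U \<inter> topspace (rel_order_topology r))"
    unfolding topspace_rel_order_topology
    unfolding rel_order_topology_def by (rule topology_generated_by_Basis)
qed

lemma order_homeomorphic_iso:
  assumes f: "iso r s f" and r: "Well_order r" and s: "Well_order s"
    and X: "X \<subseteq> Field r" and h: "order_homeomorphic r X \<alpha>"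
  shows "order_homeomorphic s (f ` X) \<alpha>"
proof -
  define g where "g = inv_into (Field r) f"
  have bij: "bij_betw f (Field r) (Field s)"
    and le: "\<And>a b. a \<in> Field r \<Longrightarrow> b \<in> Field r \<Longrightarrow> (a, b) \<in> r \<longleftrightarrow> (f a, f b) \<in> s"
    using f by (auto simp: iso_iff2)
  have gf: "\<And>x. x \<in> Field r \<Longrightarrow> g (f x) = x"
    using bij by (simp add: g_def bij_betw_def)
  have bijg: "bij_betw g (Field s) (Field r)"
    unfolding g_def by (rule bij_betw_inv_into[OF bij])
  have fg: "\<And>y. y \<in> Field s \<Longrightarrow> f (g y) = y"
    using bij by (simp add: g_def bij_betw_def f_inv_into_f)
  have isog: "iso s r g"
    unfolding iso_iff2
  proof (intro conjI ballI)
    show "bij_betw g (Field s) (Field r)" by (rule bijg)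
    fix a b assume ab: "a \<in> Field s" "b \<in> Field s"
    then have "g a \<in> Field r" "g b \<in> Field r" using bijg by (auto simp: bij_betw_def)
    then show "(a, b) \<in> s \<longleftrightarrow> (g a, g b) \<in> r" using le fg ab by simp
  qed
  have gX: "g ` f ` X = X" using X gf by force
  have fX: "f ` X \<subseteq> Field s" using X bij by (auto simp: bij_betw_def)
  have "homeomorphic_maps (rel_order_topology s) (rel_order_topology r) g f"
    using iso_continuous_map[OF f r s] iso_continuous_map[OF isog s r] fg gf
    by (simp add: homeomorphic_maps_def)
  then have hom: "homeomorphic_map (rel_order_topology s) (rel_order_topology r) g"
    by (meson homeomorphic_map_maps)
  have hom': "homeomorphic_map (subtopology (rel_order_topology s) (f ` X))
      (subtopology (rel_order_topology r) X) g"
  proof (rule homeomorphic_map_subtopologies[OF hom])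
    show "g ` (topspace (rel_order_topology s) \<inter> f ` X) = topspace (rel_order_topology r) \<inter> X"
      using X fX gX by (simp add: Int_absorb1)
  qed
  have "Refl r" "Refl s"
    using r s by (simp_all add: order_on_defs)
  then have FX: "Field (Restr r X) = X" "Field (Restr s (f ` X)) = f ` X"
    using X fX by (simp_all add: Refl_Field_Restr2)
  obtain k where k: "iso (Restr r X) \<alpha> k"
    "homeomorphic_map (subtopology (rel_order_topology r) X) (rel_order_topology \<alpha>) k"
    using h by (auto simp: order_homeomorphic_def)
  have "iso (Restr s (f ` X)) (Restr r X) g"
    unfolding iso_iff2 FX
  proof (intro conjI ballI)
    show "bij_betw g (f ` X) X"
      using bijg fX gX by (rule bij_betw_subset)
    fix a b assume ab: "a \<in> f ` X" "b \<in> f ` X"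
    then have "a \<in> Field s" "b \<in> Field s" "g a \<in> X" "g b \<in> X" using fX gX by blast+
    moreover from this have "(g a, g b) \<in> r \<longleftrightarrow> (a, b) \<in> s"
      using X le[of "g a" "g b"] fg by auto
    ultimately show "(a, b) \<in> Restr s (f ` X) \<longleftrightarrow> (g a, g b) \<in> Restr r X"
      using ab by simp
  qed
  then have "iso (Restr s (f ` X)) \<alpha> (k \<circ> g)"
    using k(1) by (rule comp_iso)
  moreover have "homeomorphic_map (subtopology (rel_order_topology s) (f ` X))
      (rel_order_topology \<alpha>) (k \<circ> g)"
    using hom' k(2) by (rule homeomorphic_map_compose)
  ultimately show ?thesis by (auto simp: order_homeomorphic_def)
qed

lemma closed_arrow_ordIso:
  assumes "(r, s) \<in> ordIso" and arrow: "closed_arrow r \<alpha> \<beta>"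
  shows "closed_arrow s \<alpha> \<beta>"
  unfolding closed_arrow_def
proof
  obtain f where f: "iso r s f" and r: "Well_order r" and s: "Well_order s"
    using assms(1) by (auto simp: ordIso_def)
  have bij: "bij_betw f (Field r) (Field s)" using f by (simp add: iso_def)
  fix c assume c: "c \<in> [Field s]\<^bsup>2\<^esup> \<rightarrow> {0, 1::nat}"
  have img: "f ` Y \<in> [Field s]\<^bsup>2\<^esup>" if "Y \<in> [Field r]\<^bsup>2\<^esup>" for Y
  proof -
    have Y: "Y \<subseteq> Field r" "finite Y" "card Y = 2" using that by (auto simp: nsets_def)
    then have "inj_on f Y" using bij by (meson bij_betw_def inj_on_subset)
    then show ?thesis using Y bij by (auto simp: nsets_def bij_betw_def card_image)
  qed
  have "(\<lambda>Y. c (f ` Y)) \<in> [Field r]\<^bsup>2\<^esup> \<rightarrow> {0, 1::nat}"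
    using c img by (auto simp: Pi_iff)
  then obtain X where X: "X \<subseteq> Field r" and
    or: "[X]\<^bsup>2\<^esup> \<subseteq> (\<lambda>Y. c (f ` Y)) -` {0} \<and> order_homeomorphic r X \<alpha> \<or>
      [X]\<^bsup>2\<^esup> \<subseteq> (\<lambda>Y. c (f ` Y)) -` {1} \<and> order_homeomorphic r X \<beta>"
    using arrow unfolding closed_arrow_def by blast
  have sub: "[f ` X]\<^bsup>2\<^esup> \<subseteq> c -` {i}" if i: "[X]\<^bsup>2\<^esup> \<subseteq> (\<lambda>Y. c (f ` Y)) -` {i}" for i
  proof
    fix Z assume "Z \<in> [f ` X]\<^bsup>2\<^esup>"
    then have Z: "Z \<subseteq> f ` X" "finite Z" "card Z = 2" by (auto simp: nsets_def)
    then obtain Y where Y: "Y \<subseteq> X" "finite Y" "Z = f ` Y" by (meson finite_subset_image)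
    have "inj_on f Y" using Y X bij by (meson bij_betw_def inj_on_subset)
    then have "Y \<in> [X]\<^bsup>2\<^esup>" using Y Z by (auto simp: nsets_def card_image)
    then show "Z \<in> c -` {i}" using i Y by auto
  qed
  have "f ` X \<subseteq> Field s" using X bij by (auto simp: bij_betw_def)
  then show "\<exists>X\<subseteq>Field s. [X]\<^bsup>2\<^esup> \<subseteq> c -` {0} \<and> order_homeomorphic s X \<alpha> \<or>
      [X]\<^bsup>2\<^esup> \<subseteq> c -` {1} \<and> order_homeomorphic s X \<beta>"
    using or sub[of 0] sub[of 1] order_homeomorphic_iso[OF f r s X, of \<alpha>]
      order_homeomorphic_iso[OF f r s X, of \<beta>]
    by (intro exI[of _ "f ` X"]) argo
qed

lemma is_closed_ramsey_number_least:
  fixes \<gamma> :: "'c rel" and \<gamma>' :: "'d rel"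
  assumes \<gamma>: "is_closed_ramsey_number \<alpha> \<beta> \<gamma>"
    and \<gamma>': "Well_order \<gamma>'" "closed_arrow \<gamma>' \<alpha> \<beta>"
  shows "\<gamma> \<le>o \<gamma>'"
proof (rule ccontr)
  have wo: "Well_order \<gamma>" using \<gamma> by (simp add: is_closed_ramsey_number_def)
  assume "\<not> \<gamma> \<le>o \<gamma>'"
  then have "\<gamma>' <o \<gamma>" using wo \<gamma>' by (simp add: not_ordLeq_iff_ordLess)
  then obtain p :: "'c rel" where p: "(\<gamma>', p) \<in> ordIso" "p <o \<gamma>"
    using internalize_ordLess[of \<gamma>' \<gamma>] by blast
  have "closed_arrow p \<alpha> \<beta>"
    using p(1) \<gamma>'(2) by (rule closed_arrow_ordIso)
  moreover have "Well_order p" using p(1) by (simp add: ordIso_def)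
  ultimately have "\<gamma> \<le>o p" using \<gamma> by (simp add: is_closed_ramsey_number_def)
  then show False using p not_ordLess_ordLeq by blast
qed

end

theory Submission
  imports Defs "HOL-Library.Diagonal_Subsequence"
begin

text \<open>
  Call a pair red if it has colour 0 and blue if it has colour 1, and suppose that the ordinal
  \<open>\<omega>\<^sup>2 \<cdot> n + \<omega> \<cdot> (n\<^sup>2 - 4) + 1\<close> is coloured with neither a blue triangle nor a red closed copy of
  \<open>\<omega> + n\<close>. The blue pairs form a triangle-free graph, so the set of blue neighbours of a point is red.
  A red closed copy of \<open>\<omega> + n\<close> is a red set consisting of a sequence, its limit \<open>p\<close>, and \<open>m = n - 1\<close>
  points above \<open>p\<close>. So a red set has fewer than \<open>m\<close> points above any of its limit points that it
  contains.

  Let \<open>A\<close> be a sequence converging to \<open>p\<close> such that \<open>A \<union> {p}\<close> is red. Thinning out \<open>A\<close>, every point \<open>q\<close>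
  may be assumed to be red to almost all of \<open>A\<close> or blue to almost all of \<open>A\<close>. The points above \<open>p\<close> fall into
  three classes: those blue to \<open>p\<close>, which form a red set; those blue to almost all of \<open>A\<close>, which form
  a red set, too; and those red to both \<open>p\<close> and almost all of \<open>A\<close>. The third class contains no \<open>m\<close>
  pairwise red points, hence has fewer than \<open>m(m + 1)/2\<close> points, by the bound for the Ramsey number
  \<open>R(3, m)\<close>. The key point (\<open>two_independent_sets\<close>) is that no point \<open>\<omega>\<^sup>2 \<cdot> k\<close> above \<open>p\<close> lies in one of
  the first two classes. Otherwise this class has fewer than \<open>m\<close> points above \<open>\<omega>\<^sup>2 \<cdot> k\<close>, so that the
  other class contains almost everything there, and it has to contain one of the limit points
  \<open>\<omega>\<^sup>2 \<cdot> n + \<omega> \<cdot> i\<close> together with almost all points that follow \<open>\<omega>\<^sup>2 \<cdot> k\<close>. With \<open>n\<^sup>2 - 4\<close> such limit points, the last of which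
  has nothing above it, the others outnumber the exceptions.

  Hence all points \<open>\<omega>\<^sup>2 \<cdot> k\<close> above \<open>p\<close> are red to \<open>p\<close> and to almost all of \<open>A\<close>. It follows first that each
  \<open>\<omega>\<^sup>2 \<cdot> k\<close> with \<open>1 \<le> k \<le> n\<close> is the limit of a red sequence that is red to it
  (\<open>second_limit_anchored\<close>), and then that these \<open>n\<close> points are pairwise red and red to almost all of
  the sequence below \<open>\<omega>\<^sup>2\<close>. This is a red closed copy of \<open>\<omega> + n\<close> after all.

  The argument is carried out in a countable linear order with suitable limit points and then applied
  to the ordinals below \<open>\<omega>\<^sup>3\<close>, written as triples of coefficients. A subset with the order type of
  \<open>\<omega> + n\<close> also has its topology if it is closed (\<open>order_topology_of_closed_subset\<close>).
\<close>

section \<open>Sequences converging to a point from below\<close>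

text \<open>
  \<open>climbs A p\<close> says that \<open>A\<close> has order type \<open>\<omega>\<close> and supremum \<open>p\<close>. In a countable ordinal, \<open>p\<close> is a limit
  of \<open>X\<close> from below exactly when \<open>X\<close> contains such a sequence, so topological closure only ever
  needs to be tested on sequences.
\<close>

definition climbs :: "'a::linorder set \<Rightarrow> 'a \<Rightarrow> bool" where
  "climbs A p \<longleftrightarrow> infinite A \<and> (\<forall>a\<in>A. a < p) \<and> (\<forall>y<p. finite {a \<in> A. a \<le> y})"

definition limit_from_below :: "'a::linorder set \<Rightarrow> 'a \<Rightarrow> bool" where
  "limit_from_below X p \<longleftrightarrow> (\<exists>A\<subseteq>X. climbs A p)"

lemma climbs_subset:
  assumes "climbs A p" "B \<subseteq> A" "infinite B"
  shows "climbs B p"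
proof -
  have "finite {a \<in> B. a \<le> y}" if "y < p" for y
  proof (rule finite_subset)
    show "{a \<in> B. a \<le> y} \<subseteq> {a \<in> A. a \<le> y}" using assms(2) by blast
    show "finite {a \<in> A. a \<le> y}" using assms(1) that unfolding climbs_def by blast
  qed
  moreover have "\<forall>a\<in>B. a < p" using assms(1,2) unfolding climbs_def by blast
  ultimately show ?thesis using assms(3) unfolding climbs_def by simp
qed

lemma climbs_strict_mono:
  fixes f :: "nat \<Rightarrow> 'a::linorder"
  assumes f: "strict_mono f" and below: "\<And>i. f i < p" and cofinal: "\<And>y. y < p \<Longrightarrow> \<exists>i. y < f i"
  shows "climbs (range f) p"
  unfolding climbs_def
proof (intro conjI allI impI ballI)
  show "infinite (range f)"
    using f by (simp add: range_inj_infinite strict_mono_imp_inj_on)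
  show "a < p" if "a \<in> range f" for a using that below by auto
  fix y assume "y < p"
  then obtain i where i: "y < f i" using cofinal by blast
  have "{a \<in> range f. a \<le> y} \<subseteq> f ` {..<i}"
  proof
    fix a assume "a \<in> {a \<in> range f. a \<le> y}"
    then obtain j where "a = f j" "f j \<le> y" by auto
    then have "f j < f i" using i by order
    then have "j < i" using f by (simp add: strict_mono_less)
    then show "a \<in> f ` {..<i}" using \<open>a = f j\<close> by auto
  qed
  then show "finite {a \<in> range f. a \<le> y}" using finite_subset by blast
qed

lemma limit_from_below_mono: "limit_from_below X p \<Longrightarrow> X \<subseteq> Y \<Longrightarrow> limit_from_below Y p"
  unfolding limit_from_below_def by blast

lemma limit_from_below_Un:
  assumes "limit_from_below (X \<union> Y) p"
  shows "limit_from_below X p \<or> limit_from_below Y p"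
proof -
  obtain A where A: "A \<subseteq> X \<union> Y" "climbs A p" using assms unfolding limit_from_below_def by blast
  have "A = (A \<inter> X) \<union> (A \<inter> Y)" using A by blast
  then have "infinite (A \<inter> X) \<or> infinite (A \<inter> Y)" using A(2) unfolding climbs_def
    by (metis finite_Un)
  then have "climbs (A \<inter> X) p \<or> climbs (A \<inter> Y) p" using climbs_subset[OF A(2)] by auto
  then show ?thesis unfolding limit_from_below_def by (meson inf_le2)
qed

lemma not_limit_from_below_finite: "finite X \<Longrightarrow> \<not> limit_from_below X p"
  unfolding limit_from_below_def climbs_def by (metis finite_subset)

lemma limit_from_below_tail:
  assumes "limit_from_below X p" "y < p"
  shows "limit_from_below {x \<in> X. y < x \<and> x < p} p"
proof -
  obtain A where A: "A \<subseteq> X" "climbs A p" using assms unfolding limit_from_below_def by blast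
  have "A - {a \<in> A. a \<le> y} \<subseteq> {x \<in> X. y < x \<and> x < p}" using A unfolding climbs_def by auto
  moreover have "infinite (A - {a \<in> A. a \<le> y})" using A(2) assms(2) unfolding climbs_def by auto
  ultimately have "climbs (A - {a \<in> A. a \<le> y}) p" using climbs_subset[OF A(2)] by blast
  then show ?thesis unfolding limit_from_below_def
    using \<open>A - {a \<in> A. a \<le> y} \<subseteq> _\<close> by blast
qed

lemma limit_from_below_infinite:
  assumes "limit_from_below X p" "y < p"
  shows "infinite {x \<in> X. y < x}"
proof
  assume "finite {x \<in> X. y < x}"
  then have "finite {x \<in> X. y < x \<and> x < p}" by (rule rev_finite_subset) auto
  then show False using limit_from_below_tail[OF assms] not_limit_from_below_finite by blast
qed

text \<open>
  From each point \<open>r\<close> of a sequence converging to \<open>s\<close>, choose a point of \<open>X\<close> between \<open>r\<close> and the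
  predecessor of \<open>r\<close> in the sequence. The chosen points interleave with the given sequence and
  therefore have the same limit.
\<close>

lemma limit_from_below_trans:
  assumes R: "limit_from_below R s" and X: "\<And>r. r \<in> R \<Longrightarrow> limit_from_below X r"
  shows "limit_from_below X s"
proof -
  obtain R' where R': "R' \<subseteq> R" "climbs R' s" using R unfolding limit_from_below_def by blast
  have pred: "finite {r' \<in> R'. r' < r}" if "r \<in> R'" for r
  proof -
    have "finite {a \<in> R'. a \<le> r}" using R'(2) that unfolding climbs_def by blast
    then show ?thesis by (rule rev_finite_subset) auto
  qed
  have "\<exists>x\<in>X. x < r \<and> (\<forall>r'\<in>R'. r' < r \<longrightarrow> r' < x)" if r: "r \<in> R'" for r
  proof (cases "{r' \<in> R'. r' < r} = {}")
    case True
    obtain A where A: "A \<subseteq> X" "climbs A r" using X r R'(1) unfolding limit_from_below_def by blast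
    then have "A \<noteq> {}" unfolding climbs_def by auto
    then obtain x where "x \<in> X" "x < r" using A unfolding climbs_def by blast
    then show ?thesis using True by auto
  next
    case False
    define y where "y = Max {r' \<in> R'. r' < r}"
    have y: "y \<in> {r' \<in> R'. r' < r}" unfolding y_def using False pred[OF r] by (rule Max_in[rotated])
    then have "limit_from_below {x \<in> X. y < x \<and> x < r} r"
      using X r R'(1) limit_from_below_tail by blast
    then have "{x \<in> X. y < x \<and> x < r} \<noteq> {}" using not_limit_from_below_finite by force
    then obtain x where x: "x \<in> X" "y < x" "x < r" by blast
    moreover have "r' < x" if "r' \<in> R'" "r' < r" for r'
    proof -
      have "r' \<le> y" unfolding y_def using pred[OF r] that by (intro Max_ge) auto
      then show ?thesis using x by order
    qed
    ultimately show ?thesis by blast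
  qed
  then obtain x where x: "\<And>r. r \<in> R' \<Longrightarrow> x r \<in> X" "\<And>r. r \<in> R' \<Longrightarrow> x r < r"
    "\<And>r r'. r \<in> R' \<Longrightarrow> r' \<in> R' \<Longrightarrow> r' < r \<Longrightarrow> r' < x r"
    by metis
  have "inj_on x R'"
  proof (rule linorder_inj_onI')
    fix r r' assume "r \<in> R'" "r' \<in> R'" "r < r'"
    then have "x r < r" "r < x r'" using x by blast+
    then show "x r \<noteq> x r'" by order
  qed
  then have inf: "infinite (x ` R')" using R'(2) unfolding climbs_def by (simp add: finite_image_iff)
  have "climbs (x ` R') s"
    unfolding climbs_def
  proof (intro conjI ballI allI impI)
    show "infinite (x ` R')" by (rule inf)
    show "a < s" if "a \<in> x ` R'" for a
      using that R'(2) x(2) unfolding climbs_def by (metis imageE order.strict_trans)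
    fix y assume y: "y < s"
    \<comment> \<open>Only the first \<open>r\<close> above \<open>y\<close> can have \<open>x r \<le> y\<close>: for a later one, the first one lies
      strictly between \<open>y\<close> and \<open>x r\<close>.\<close>
    define T where "T = {r \<in> R'. x r \<le> y \<and> y < r}"
    have "finite T"
    proof (cases "T = {}")
      case False
      then obtain t where t: "t \<in> T" by blast
      have "r = t" if "r \<in> T" for r
      proof (rule ccontr)
        assume "r \<noteq> t"
        then consider "r < t" | "t < r" by (meson linorder_neqE)
        then show False
        proof cases
          case 1
          then have "r < x t" using x(3)[of t r] t that unfolding T_def by blast
          then show False using t that unfolding T_def by auto
        next
          case 2
          then have "t < x r" using x(3)[of r t] t that unfolding T_def by blast
          then show False using t that unfolding T_def by auto
        qed
      qed
      then have "T \<subseteq> {t}" by blast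
      then show ?thesis using finite_subset by blast
    qed simp
    moreover have "finite {r \<in> R'. r \<le> y}" using R'(2) y unfolding climbs_def by blast
    ultimately have "finite (x ` (T \<union> {r \<in> R'. r \<le> y}))" by blast
    moreover have "{a \<in> x ` R'. a \<le> y} \<subseteq> x ` (T \<union> {r \<in> R'. r \<le> y})"
      unfolding T_def by auto
    ultimately show "finite {a \<in> x ` R'. a \<le> y}" by (rule rev_finite_subset)
  qed
  then show ?thesis unfolding limit_from_below_def using x(1) by blast
qed

section \<open>Independent sets in triangle-free graphs\<close>

definition independent_in :: "('a \<Rightarrow> 'a \<Rightarrow> bool) \<Rightarrow> 'a set \<Rightarrow> bool" where
  "independent_in E X \<longleftrightarrow> (\<forall>x\<in>X. \<forall>y\<in>X. \<not> E x y)"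

locale triangle_free =
  fixes E :: "'a \<Rightarrow> 'a \<Rightarrow> bool"
  assumes edge_sym: "E x y \<Longrightarrow> E y x"
    and edge_irrefl: "\<not> E x x"
    and no_triangle: "E x y \<Longrightarrow> E y z \<Longrightarrow> E x z \<Longrightarrow> False"
begin

lemma independent_neighbours: "independent_in E {q. E p q}"
  unfolding independent_in_def using no_triangle by blast

text \<open>
  The classical bound \<open>R(3, m) \<le> m(m + 1)/2\<close>. A vertex with at least \<open>m\<close> neighbours gives an
  independent set at once; a vertex with fewer neighbours is put into the independent set and
  deleted together with its neighbours.
\<close>

lemma independent_subset_of_large_set:
  assumes "finite V" "m * (m + 1) div 2 \<le> card V"
  shows "\<exists>Q\<subseteq>V. card Q = m \<and> independent_in E Q"
  using assms
proof (induction m arbitrary: V)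
  case 0
  have "{} \<subseteq> V \<and> card ({}::'a set) = 0 \<and> independent_in E {}" by (simp add: independent_in_def)
  then show ?case by blast
next
  case (Suc m)
  have half: "Suc m * (Suc m + 1) div 2 = m * (m + 1) div 2 + Suc m" by simp
  then have "V \<noteq> {}" using Suc.prems by auto
  then obtain v where v: "v \<in> V" by blast
  define N where "N = {q \<in> V. E v q}"
  have N: "finite N" "independent_in E N" using Suc.prems(1) no_triangle
    unfolding N_def independent_in_def by auto
  show ?case
  proof (cases "Suc m \<le> card N")
    case True
    then obtain Q where "Q \<subseteq> N" "card Q = Suc m" by (rule obtain_subset_with_card_n)
    then show ?thesis using N unfolding N_def independent_in_def by blast
  next
    case False
    have vN: "v \<notin> N" using edge_irrefl unfolding N_def by blast
    have "insert v N \<subseteq> V" using v unfolding N_def by blast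
    then have "card (V - insert v N) = card V - Suc (card N)"
      using N(1) vN by (simp add: card_Diff_subset)
    then have "m * (m + 1) div 2 \<le> card (V - insert v N)"
      using False Suc.prems(2) half by linarith
    then obtain Q where Q: "Q \<subseteq> V - insert v N" "card Q = m" "independent_in E Q"
      using Suc.IH[of "V - insert v N"] Suc.prems(1) by blast
    have "finite Q" using Q(1) Suc.prems(1) by (meson finite_Diff finite_subset)
    moreover have "v \<notin> Q" using Q(1) by blast
    ultimately have "card (insert v Q) = Suc m" using Q(2) by simp
    moreover have "\<not> E v q \<and> \<not> E q v" if "q \<in> Q" for q
    proof -
      have "q \<in> V" "q \<notin> N" using Q(1) that by auto
      then have "\<not> E v q" unfolding N_def by simp
      then show ?thesis using edge_sym by blast
    qed
    then have "independent_in E (insert v Q)"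
      using Q(3) edge_irrefl unfolding independent_in_def by simp
    ultimately show ?thesis using v Q(1) by blast
  qed
qed

lemma infinite_independent_subset:
  assumes "infinite A"
  shows "\<exists>B\<subseteq>A. infinite B \<and> independent_in E B"
proof -
  define f where "f e = (if \<exists>x y. e = {x, y} \<and> E x y then 1 else 0 :: nat)" for e
  have f: "f {x, y} = (if E x y then 1 else 0)" for x y
    unfolding f_def using edge_sym by (auto simp: doubleton_eq_iff)
  obtain B t where B: "B \<subseteq> A" "infinite B" "t < 2"
    "\<forall>x\<in>B. \<forall>y\<in>B. x \<noteq> y \<longrightarrow> f {x, y} = t"
    using Ramsey2[OF assms, of f 2] f by force
  have "t = 0"
  proof (rule ccontr)
    assume "t \<noteq> 0"
    then have adj: "E x y" if "x \<in> B" "y \<in> B" "x \<noteq> y" for x y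
      using B(4) f that by metis
    obtain K where K: "K \<subseteq> B" "card K = 3" using infinite_arbitrarily_large[OF B(2)] by blast
    then obtain x y z where "K = {x, y, z}" "x \<noteq> y" "y \<noteq> z" "x \<noteq> z"
      by (metis card_3_iff)
    then show False using adj[of x y] adj[of y z] adj[of x z] no_triangle K by blast
  qed
  then have "independent_in E B" using B(4) f edge_irrefl unfolding independent_in_def
    by (metis zero_neq_one)
  then show ?thesis using B by blast
qed

end

section \<open>Sequences that decide every vertex\<close>

definition decides :: "('a \<Rightarrow> 'a \<Rightarrow> bool) \<Rightarrow> 'a set \<Rightarrow> 'a \<Rightarrow> bool" where
  "decides E A q \<longleftrightarrow> finite {a \<in> A. E a q} \<or> finite {a \<in> A. \<not> E a q}"

text \<open>
  A diagonal argument: the countably many vertices \<open>q\<close> are treated one after the other, each time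
  thinning out \<open>A\<close> so that \<open>q\<close> is joined to almost all or almost none of what is left. The set \<open>B\<close>
  takes the place of an ultrafilter on \<open>A\<close>.
\<close>

lemma infinite_subset_deciding_all:
  fixes A :: "'a set" and E :: "'a \<Rightarrow> 'b::countable \<Rightarrow> bool"
  assumes "infinite A"
  shows "\<exists>B\<subseteq>A. infinite B \<and>
    (\<forall>q. finite {a \<in> B. E a q} \<or> finite {a \<in> B. \<not> E a q})"
proof -
  obtain u :: "nat \<Rightarrow> 'a" where u: "inj u" "range u \<subseteq> A"
    using assms infinite_countable_subset by blast
  define P where "P k s \<longleftrightarrow> (\<forall>\<^sub>\<infinity>i. E (u (s i)) (from_nat k)) \<or> (\<forall>\<^sub>\<infinity>i. \<not> E (u (s i)) (from_nat k))"
    for k :: nat and s :: "nat \<Rightarrow> nat"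
  interpret subseqs P
  proof
    fix k and s :: "nat \<Rightarrow> nat"
    show "\<exists>r'. strict_mono r' \<and> P k (s \<circ> r')"
    proof (cases "finite {i. E (u (s i)) (from_nat k)}")
      case True
      then have "P k (s \<circ> id)" unfolding P_def by (simp add: MOST_iff_cofinite)
      then show ?thesis using strict_mono_id by (intro exI[of _ id] conjI)
    next
      case False
      then obtain r :: "nat \<Rightarrow> nat" where r: "strict_mono r" "\<forall>i. r i \<in> {i. E (u (s i)) (from_nat k)}"
        using infinite_enumerate[OF False] by (elim exE conjE)
      then have "\<forall>i. E (u ((s \<circ> r) i)) (from_nat k)" by simp
      then have "P k (s \<circ> r)" unfolding P_def by (intro disjI1 always_eventually)
      with r(1) show ?thesis by (intro exI[of _ r] conjI)
    qed
  qed
  have stable: "P k (s \<circ> r)" if "strict_mono r" "P k s" for r s k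
    using that(2) eventually_subseq[OF that(1), of "\<lambda>i. E (u (s i)) (from_nat k)"]
      eventually_subseq[OF that(1), of "\<lambda>i. \<not> E (u (s i)) (from_nat k)"]
    unfolding P_def cofinite_eq_sequentially o_def by argo
  define d where "d = diagseq"
  have P: "P k d" for k
  proof -
    have "P k (d \<circ> (+) (Suc k))" unfolding d_def by (rule diagseq_holds) (rule stable)
    moreover have "d \<circ> (+) (Suc k) = (\<lambda>i. d (i + Suc k))" by (auto simp: add.commute)
    ultimately have "P k (\<lambda>i. d (i + Suc k))" by simp
    then show ?thesis unfolding P_def cofinite_eq_sequentially
      using eventually_sequentially_seg[where P = "\<lambda>i. E (u (d i)) (from_nat k)" and k = "Suc k"]
        eventually_sequentially_seg[where P = "\<lambda>i. \<not> E (u (d i)) (from_nat k)" and k = "Suc k"]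
      by argo
  qed
  define v where "v = u \<circ> d"
  have v: "inj v" unfolding v_def d_def using u(1) subseq_diagseq
    by (simp add: inj_compose strict_mono_imp_inj_on)
  have "finite {a \<in> range v. E a q} \<or> finite {a \<in> range v. \<not> E a q}" for q
  proof -
    have "{a \<in> range v. E a q} = v ` {i. E (v i) q}"
      "{a \<in> range v. \<not> E a q} = v ` {i. \<not> E (v i) q}" by auto
    then show ?thesis using P[of "to_nat q"] unfolding P_def v_def
      by (auto simp: MOST_iff_cofinite)
  qed
  moreover have "range v \<subseteq> A" using u(2) unfolding v_def by auto
  moreover have "infinite (range v)" using v by (simp add: range_inj_infinite)
  ultimately show ?thesis by blast
qed

section \<open>Colourings without a red closed copy\<close>

text \<open>
  The edges of \<open>E\<close> are the blue pairs, so independent sets are the red homogeneous sets. The locale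
  collects the assumptions of a proof by contradiction: there is neither a blue triangle nor a red
  closed copy of \<open>\<omega> + (m + 1)\<close>, that is, a sequence with its limit \<open>p\<close> and \<open>m\<close> further points above \<open>p\<close>.
\<close>

locale no_red_copy = triangle_free E
  for E :: "'a::{linorder,countable} \<Rightarrow> 'a \<Rightarrow> bool" +
  fixes S :: "'a set" and m :: nat
  assumes m: "m \<ge> 1"
    and no_copy: "climbs A p \<Longrightarrow> (\<And>q. q \<in> Q \<Longrightarrow> p < q) \<Longrightarrow> card Q = m \<Longrightarrow>
      A \<union> insert p Q \<subseteq> S \<Longrightarrow> independent_in E (A \<union> insert p Q) \<Longrightarrow> False"
begin

lemma few_above_limit:
  assumes X: "independent_in E X" "X \<subseteq> S" "limit_from_below X p" "p \<in> X"
  shows "finite {x \<in> X. p < x}" "card {x \<in> X. p < x} < m"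
proof -
  obtain A where A: "A \<subseteq> X" "climbs A p" using X(3) unfolding limit_from_below_def by blast
  have no: False if "Q \<subseteq> {x \<in> X. p < x}" "card Q = m" for Q
  proof (rule no_copy[OF A(2) _ that(2)])
    show "q \<in> Q \<Longrightarrow> p < q" for q using that by blast
    have sub: "A \<union> insert p Q \<subseteq> X" using A(1) that(1) X(4) by blast
    then show "A \<union> insert p Q \<subseteq> S" using X(2) by blast
    show "independent_in E (A \<union> insert p Q)" using sub X(1) unfolding independent_in_def by blast
  qed
  show fin: "finite {x \<in> X. p < x}"
  proof (rule ccontr)
    assume "infinite {x \<in> X. p < x}"
    from infinite_arbitrarily_large[OF this, of m] show False using no by metis
  qed
  show "card {x \<in> X. p < x} < m"
  proof (rule ccontr)
    assume "\<not> card {x \<in> X. p < x} < m"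
    then have "m \<le> card {x \<in> X. p < x}" by simp
    then show False using no by (rule obtain_subset_with_card_n)
  qed
qed

text \<open>
  An anchored sequence is the initial segment \<open>\<omega> + 1\<close> of a prospective red copy, thinned out so that
  every vertex has a definite colour towards it.
\<close>

definition anchored :: "'a set \<Rightarrow> 'a \<Rightarrow> bool" where
  "anchored A p \<longleftrightarrow> climbs A p \<and> insert p A \<subseteq> S \<and> independent_in E (insert p A) \<and> (\<forall>q. decides E A q)"

lemma anchored_exists:
  assumes "p \<in> S" "limit_from_below {x \<in> S. \<not> E x p} p"
  shows "\<exists>A. anchored A p"
proof -
  obtain A where A: "A \<subseteq> {x \<in> S. \<not> E x p}" "climbs A p"
    using assms(2) unfolding limit_from_below_def by blast
  then have "infinite A" unfolding climbs_def by blast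
  then obtain B where B: "B \<subseteq> A" "infinite B" "independent_in E B"
    using infinite_independent_subset by blast
  obtain C where C: "C \<subseteq> B" "infinite C" "\<And>q. decides E C q"
    using infinite_subset_deciding_all[OF B(2), of E] unfolding decides_def by blast
  have "climbs C p" using climbs_subset[OF A(2)] B C by blast
  moreover have "insert p C \<subseteq> S" using A B C assms(1) by blast
  moreover have "independent_in E (insert p C)"
  proof -
    have "\<not> E x p \<and> \<not> E p x" if "x \<in> C" for x using that A(1) B(1) C(1) edge_sym by blast
    moreover have "\<not> E x y" if "x \<in> C" "y \<in> C" for x y
      using that B(3) C(1) unfolding independent_in_def by blast
    ultimately show ?thesis using edge_irrefl unfolding independent_in_def by simp
  qed
  ultimately show ?thesis using C(3) unfolding anchored_def by blast
qed

definition red_to :: "'a set \<Rightarrow> 'a \<Rightarrow> 'a set" where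
  "red_to A p = {q \<in> S. p < q \<and> \<not> E p q \<and> finite {a \<in> A. E a q}}"

lemma cofinitely_red:
  assumes A: "anchored A p" and Q: "finite Q" "Q \<subseteq> red_to A p" "independent_in E Q"
  shows "climbs {a \<in> A. \<forall>q\<in>Q. \<not> E a q} p \<and>
    independent_in E ({a \<in> A. \<forall>q\<in>Q. \<not> E a q} \<union> insert p Q)"
proof -
  define B where "B = {a \<in> A. \<forall>q\<in>Q. \<not> E a q}"
  have cl: "climbs A p" and ind: "independent_in E (insert p A)"
    using A unfolding anchored_def by blast+
  then have inf: "infinite A" unfolding climbs_def by blast
  have "finite {a \<in> A. E a q}" if "q \<in> Q" for q using that Q(2) unfolding red_to_def by auto
  then have "finite (\<Union>q\<in>Q. {a \<in> A. E a q})" by (rule finite_UN_I[OF Q(1)])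
  moreover have "B = A - (\<Union>q\<in>Q. {a \<in> A. E a q})" unfolding B_def by blast
  ultimately have "infinite B" using inf by simp
  moreover have "B \<subseteq> A" unfolding B_def by blast
  ultimately have "climbs B p" using climbs_subset[OF cl] by blast
  moreover have "independent_in E (B \<union> insert p Q)"
  proof -
    have "\<not> E a q" if "a \<in> B" "q \<in> Q" for a q
      using that unfolding B_def by simp
    moreover have "\<not> E p q" if "q \<in> Q" for q
      using that Q(2) unfolding red_to_def by auto
    moreover have "\<not> E x y" if "x \<in> insert p B" "y \<in> insert p B" for x y
    proof -
      have "x \<in> insert p A" "y \<in> insert p A" using that unfolding B_def by auto
      then show ?thesis using bspec[OF bspec[OF ind[unfolded independent_in_def]]] by blast
    qed
    moreover have "\<not> E x y" if "x \<in> Q" "y \<in> Q" for x y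
      using that Q(3) unfolding independent_in_def by blast
    ultimately show ?thesis unfolding independent_in_def using edge_sym by (metis Un_iff insert_iff)
  qed
  ultimately show ?thesis unfolding B_def by simp
qed

lemma no_independent_red_to:
  assumes A: "anchored A p" and Q: "Q \<subseteq> red_to A p" "independent_in E Q" "card Q = m"
  shows False
proof -
  have "finite Q" using Q(3) m card.infinite by fastforce
  note red = cofinitely_red[OF A this Q(1,2)]
  show False
  proof (rule no_copy[OF conjunct1[OF red] _ Q(3) _ conjunct2[OF red]])
    show "p < q" if "q \<in> Q" for q using that Q(1) unfolding red_to_def by blast
    show "{a \<in> A. \<forall>q\<in>Q. \<not> E a q} \<union> insert p Q \<subseteq> S"
      using A Q(1) unfolding anchored_def red_to_def by blast
  qed
qed

text \<open>
  Among sufficiently many points that are red to \<open>p\<close> and to almost all of \<open>A\<close>, the triangle-free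
  graph has \<open>m\<close> pairwise red ones. These complete \<open>A \<union> {p}\<close> to a forbidden copy.
\<close>

lemma few_red_to:
  assumes A: "anchored A p"
  shows "finite (red_to A p)" "card (red_to A p) < m * (m + 1) div 2"
proof -
  have no: False if V: "V \<subseteq> red_to A p" "finite V" "m * (m + 1) div 2 \<le> card V" for V
  proof -
    obtain Q where "Q \<subseteq> V" "card Q = m" "independent_in E Q"
      using independent_subset_of_large_set[OF V(2,3)] by blast
    then show False using no_independent_red_to[OF A, of Q] V(1) by blast
  qed
  show fin: "finite (red_to A p)"
  proof (rule ccontr)
    assume "infinite (red_to A p)"
    from infinite_arbitrarily_large[OF this, of "m * (m + 1) div 2"] show False
      using no by (metis order_refl)
  qed
  show "card (red_to A p) < m * (m + 1) div 2"
    using no[OF order_refl fin] by (meson leI)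
qed

text \<open>
  Two points blue to almost all of \<open>A\<close> have a common blue neighbour in \<open>A\<close>, so they cannot form a
  blue pair themselves.
\<close>

lemma independent_blue_to:
  assumes A: "anchored A p"
  shows "independent_in E {q. infinite {a \<in> A. E a q}}"
  unfolding independent_in_def
proof (intro ballI notI)
  fix q q' assume q: "q \<in> {q. infinite {a \<in> A. E a q}}" "q' \<in> {q. infinite {a \<in> A. E a q}}" and e: "E q q'"
  have "finite {a \<in> A. \<not> E a q}" "finite {a \<in> A. \<not> E a q'}"
    using q A unfolding anchored_def decides_def by blast+
  moreover have "infinite A" using A unfolding anchored_def climbs_def by blast
  ultimately have "infinite (A - ({a \<in> A. \<not> E a q} \<union> {a \<in> A. \<not> E a q'}))" by simp
  then have "A - ({a \<in> A. \<not> E a q} \<union> {a \<in> A. \<not> E a q'}) \<noteq> {}" by (rule infinite_imp_nonempty)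
  then obtain a where "a \<in> A" "E a q" "E a q'" by blast
  then show False using no_triangle[of a q q'] e by blast
qed

end

section \<open>Spaces with many limits of limits\<close>

text \<open>
  \<open>P\<close> plays the role of the points \<open>\<omega>\<^sup>2 \<cdot> k\<close> with \<open>1 \<le> k \<le> n\<close>, where \<open>n = m + 1\<close>, and \<open>R\<close> that of the
  points \<open>\<omega>\<^sup>2 \<cdot> n + \<omega> \<cdot> i\<close> with \<open>1 \<le> i < n\<^sup>2 - 4\<close>. The topmost limit point is left out of \<open>R\<close> because
  nothing lies above it. Note that \<open>n\<^sup>2 - 5 = m\<^sup>2 + 2 m - 4\<close>.
\<close>

locale large_space = no_red_copy E S m
  for E :: "'a::{linorder,countable} \<Rightarrow> 'a \<Rightarrow> bool" and S m +
  fixes P R :: "'a set"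
  assumes m2: "m \<ge> 2"
    and P: "P \<subseteq> S" "card P = m + 1" "\<And>s. s \<in> P \<Longrightarrow> limit_from_below {r \<in> S. limit_from_below S r} s"
    and R: "R \<subseteq> S" "finite R" "card R + 4 \<ge> m\<^sup>2 + 2 * m"
      "\<And>r. r \<in> R \<Longrightarrow> limit_from_below S r" "\<And>r. r \<in> R \<Longrightarrow> infinite {x \<in> S. r < x}"
      "\<And>s r. s \<in> P \<Longrightarrow> r \<in> R \<Longrightarrow> s < r"
begin

text \<open>
  Both \<open>X\<close> and \<open>Y\<close> are red, so by \<open>few_above_limit\<close> each has only few points above any of its
  limit points that belong to it. If \<open>s \<in> X\<close> is a limit of limits, then it is a limit of points of \<open>X\<close>:
  otherwise \<open>Y\<close> would contain limit points just below \<open>s\<close>, and each of those, having infinitely many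
  points of \<open>Y\<close> above it, would have to be a limit of points of \<open>X\<close>. So \<open>X\<close> is exhausted shortly after
  \<open>s\<close>, at most \<open>(m - 1) + (m(m + 1)/2 - 1)\<close> points above \<open>s\<close> are outside \<open>Y\<close>, and since this number is
  smaller than the size of \<open>R\<close>, some \<open>r \<in> R\<close> belongs to \<open>Y\<close>. Almost all points near and above \<open>r\<close>
  are in \<open>Y\<close> as well, which gives a red copy.
\<close>

lemma two_independent_sets:
  assumes XY: "X \<subseteq> S" "Y \<subseteq> S" "independent_in E X" "independent_in E Y"
    and F: "finite F" "card F < m * (m + 1) div 2"
    and cover: "{q \<in> S. p < q} \<subseteq> X \<union> Y \<union> F"
    and s: "s \<in> P" "p < s" "s \<in> X"
  shows False
proof -
  have covers: "limit_from_below X r \<or> limit_from_below Y r" if "limit_from_below Z r" "p < r" "Z \<subseteq> S" for Z r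
  proof -
    have "limit_from_below {x \<in> Z. p < x \<and> x < r} r" by (rule limit_from_below_tail[OF that(1,2)])
    then have "limit_from_below ((X \<union> Y) \<union> F) r"
      by (rule limit_from_below_mono) (use cover that(3) in blast)
    then show ?thesis using limit_from_below_Un not_limit_from_below_finite[OF F(1)] by blast
  qed
  have Xs: "limit_from_below X s"
  proof (rule ccontr)
    assume nX: "\<not> limit_from_below X s"
    define T where "T = {r \<in> S. limit_from_below S r \<and> p < r \<and> r < s}"
    have "limit_from_below {x \<in> {r \<in> S. limit_from_below S r}. p < x \<and> x < s} s"
      using limit_from_below_tail[OF P(3)[OF s(1)] s(2)] .
    then have "limit_from_below T s"
      by (rule limit_from_below_mono) (auto simp: T_def)
    then have "limit_from_below (T \<inter> X \<union> T \<inter> Y \<union> F) s"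
      by (rule limit_from_below_mono) (use cover in \<open>auto simp: T_def\<close>)
    moreover have "\<not> limit_from_below (T \<inter> X) s" using nX limit_from_below_mono by blast
    ultimately have TY: "limit_from_below (T \<inter> Y) s"
      using limit_from_below_Un not_limit_from_below_finite[OF F(1)] by blast
    have "limit_from_below X r" if r: "r \<in> T \<inter> Y" for r
    proof (rule ccontr)
      assume "\<not> limit_from_below X r"
      then have "limit_from_below Y r" using covers[of S r] r unfolding T_def by blast
      then have "finite {x \<in> Y. r < x}" using few_above_limit(1)[OF XY(4,2)] r by blast
      moreover have "infinite {x \<in> Y. r < x}"
        using limit_from_below_infinite[OF limit_from_below_mono[OF TY]] r unfolding T_def by blast
      ultimately show False by blast
    qed
    then show False using nX limit_from_below_trans[OF TY] by blast
  qed
  note few = few_above_limit[OF XY(3,1) Xs s(3)]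
  define B where "B = {x \<in> X. s < x} \<union> F"
  have B: "finite B" using few F unfolding B_def by blast
  have "card B \<le> card {x \<in> X. s < x} + card F" unfolding B_def by (rule card_Un_le)
  then have "card B + 2 \<le> m + m * (m + 1) div 2" using few(2) F(2) by linarith
  then have "card B < card R"
  proof -
    have "2 * (m * (m + 1) div 2) \<le> m\<^sup>2 + m" by (simp add: power2_eq_square)
    moreover have "2 * m \<le> m\<^sup>2" using m2 by (simp add: power2_eq_square)
    ultimately show ?thesis using R(3) m2 \<open>card B + 2 \<le> _\<close> by linarith
  qed
  then obtain r where r: "r \<in> R" "r \<notin> B"
    by (meson B card_mono linorder_not_le subsetI)
  have sr: "s < r" using R(6) s(1) r(1) .
  have above: "{x \<in> S. s < x} \<subseteq> Y \<union> B" using cover s(2) unfolding B_def by auto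
  have rY: "r \<in> Y" using above r sr R(1) by blast
  have "limit_from_below {x \<in> S. s < x \<and> x < r} r" by (rule limit_from_below_tail[OF R(4)[OF r(1)] sr])
  then have "limit_from_below (Y \<union> B) r"
    by (rule limit_from_below_mono) (use above in blast)
  then have "limit_from_below Y r" using limit_from_below_Un not_limit_from_below_finite[OF B] by blast
  then have "finite {x \<in> Y. r < x}" using few_above_limit(1)[OF XY(4,2)] rY by blast
  then have "finite ({x \<in> Y. r < x} \<union> B)" using B by blast
  moreover have "{x \<in> S. r < x} \<subseteq> {x \<in> Y. r < x} \<union> B" using above sr by auto
  ultimately show False using R(5)[OF r(1)] finite_subset by blast
qed

text \<open>
  Points above \<open>p\<close> that are not red to the anchored sequence with its limit are blue to \<open>p\<close> or to
  almost all of the sequence. Both kinds form red sets, so the preceding lemma applies to them, with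
  \<open>X\<close> the kind to which \<open>s\<close> belongs.
\<close>

lemma second_limits_red_to:
  assumes A: "anchored A p" and s: "s \<in> P" "p < s"
  shows "s \<in> red_to A p"
proof (rule ccontr)
  assume n: "s \<notin> red_to A p"
  define X where "X = {q \<in> S. E p q}"
  define Y where "Y = {q \<in> S. infinite {a \<in> A. E a q}}"
  have ind: "independent_in E X" "independent_in E Y"
    using independent_neighbours[of p] independent_blue_to[OF A]
    unfolding X_def Y_def independent_in_def by blast+
  have sub: "X \<subseteq> S" "Y \<subseteq> S" unfolding X_def Y_def by auto
  have cover: "{q \<in> S. p < q} \<subseteq> X \<union> Y \<union> red_to A p"
    "{q \<in> S. p < q} \<subseteq> Y \<union> X \<union> red_to A p" unfolding X_def Y_def red_to_def by auto
  have "s \<in> X \<or> s \<in> Y" using n s P(1) cover by blast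
  then show False
    using two_independent_sets[OF sub ind few_red_to[OF A] cover(1) s]
      two_independent_sets[OF sub(2,1) ind(2,1) few_red_to[OF A] cover(2) s] by blast
qed

text \<open>
  Suppose that almost all limit points \<open>r\<close> near \<open>s\<close> are blue to \<open>s\<close>. None of them can be the limit of
  points red to it, since otherwise it would carry an anchored sequence and \<open>s\<close> would be red to it. So
  \<open>r\<close> is a limit of points blue to \<open>r\<close>, and these are red to \<open>s\<close> for lack of blue triangles.
\<close>

lemma second_limit_anchored:
  assumes s: "s \<in> P"
  shows "\<exists>A. anchored A s"
proof (rule anchored_exists)
  show sS: "s \<in> S" using s P(1) by blast
  show "limit_from_below {x \<in> S. \<not> E x s} s"
  proof (rule ccontr)
    assume n: "\<not> limit_from_below {x \<in> S. \<not> E x s} s"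
    obtain Q where Q: "Q \<subseteq> {r \<in> S. limit_from_below S r}" "climbs Q s"
      using P(3)[OF s] unfolding limit_from_below_def by blast
    have "limit_from_below ({r \<in> Q. \<not> E r s} \<union> {r \<in> Q. E r s}) s"
      unfolding limit_from_below_def using Q(2) by blast
    moreover have "\<not> limit_from_below {r \<in> Q. \<not> E r s} s"
      using n limit_from_below_mono[of _ s "{x \<in> S. \<not> E x s}"] Q(1) by blast
    ultimately have blue: "limit_from_below {r \<in> Q. E r s} s" using limit_from_below_Un by blast
    have "limit_from_below {x \<in> S. \<not> E x s} r" if r: "r \<in> {r \<in> Q. E r s}" for r
    proof -
      have rs: "r < s" "r \<in> S" "limit_from_below S r" using Q r unfolding climbs_def by auto
      have "\<not> limit_from_below {x \<in> S. \<not> E x r} r"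
      proof
        assume "limit_from_below {x \<in> S. \<not> E x r} r"
        then obtain A where "anchored A r" using anchored_exists rs(2) by blast
        then have "s \<in> red_to A r" using second_limits_red_to s rs(1) by blast
        then show False using r unfolding red_to_def by blast
      qed
      moreover have "S = {x \<in> S. \<not> E x r} \<union> {x \<in> S. E x r}" by blast
      ultimately have "limit_from_below {x \<in> S. E x r} r"
        using limit_from_below_Un rs(3) by metis
      then show ?thesis
        by (rule limit_from_below_mono) (use r no_triangle edge_sym in blast)
    qed
    then show False using n limit_from_below_trans[OF blue] by blast
  qed
qed

text \<open>
  Every point of \<open>P\<close> carries an anchored sequence and therefore is red to all later points of \<open>P\<close>. The
  sequence at the least point of \<open>P\<close> together with all of \<open>P\<close> is the forbidden copy.
\<close>

lemma colouring_impossible: False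
proof -
  have fin: "finite P" using P(2) card.infinite by fastforce
  have ne: "P \<noteq> {}" using P(2) by auto
  define s where "s = Min P"
  define Q where "Q = P - {s}"
  have s: "s \<in> P" unfolding s_def using fin ne by simp
  have above: "s < t" if "t \<in> Q" for t
    using that fin unfolding Q_def s_def by (metis DiffD1 DiffD2 Min_le insertI1 order_le_imp_less_or_eq)
  obtain A where A: "anchored A s" using second_limit_anchored s by blast
  show False
  proof (rule no_independent_red_to[OF A])
    show "Q \<subseteq> red_to A s" using second_limits_red_to[OF A] above unfolding Q_def by blast
    show "card Q = m" using P(2) s fin unfolding Q_def by simp
    have less: "\<not> E t t'" if t: "t \<in> P" "t' \<in> P" "t < t'" for t t'
    proof -
      obtain B where "anchored B t" using second_limit_anchored[OF t(1)] by blast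
      then have "t' \<in> red_to B t" using second_limits_red_to t(2,3) by blast
      then show ?thesis unfolding red_to_def by blast
    qed
    show "independent_in E Q"
      unfolding independent_in_def Q_def
      using less edge_irrefl edge_sym by (metis DiffD1 linorder_neqE)
  qed
qed

end

section \<open>Order topologies of closed subsets\<close>

definition ord_on :: "'a::linorder set \<Rightarrow> 'a rel" where
  "ord_on X = {(a, b). a \<in> X \<and> b \<in> X \<and> a \<le> b}"

lemma Field_ord_on [simp]: "Field (ord_on X) = X"
  unfolding ord_on_def Field_def by auto

lemma Restr_ord_on: "X \<subseteq> S \<Longrightarrow> Restr (ord_on S) X = ord_on X"
  unfolding ord_on_def by auto

lemma underS_ord_on [simp]: "b \<in> X \<Longrightarrow> underS (ord_on X) b = {x \<in> X. x < b}"
  and aboveS_ord_on [simp]: "b \<in> X \<Longrightarrow> aboveS (ord_on X) b = {x \<in> X. b < x}"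
  unfolding ord_on_def underS_def aboveS_def by auto

text \<open>
  Sums and products of ordinals are identified with sets of points by means of such an embedding, which
  yields the well-ordering and the isomorphism at the same time.
\<close>

lemma order_embedding_into_wellorder:
  fixes f :: "'a \<Rightarrow> 'b::wellorder"
  assumes inj: "inj_on f D" and r: "\<And>a b. (a, b) \<in> r \<longleftrightarrow> a \<in> D \<and> b \<in> D \<and> f a \<le> f b"
  shows "Well_order r" "iso r (ord_on (f ` D)) f"
proof -
  have F: "Field r = D" using r unfolding Field_def by auto
  have "wf (r - Id)"
  proof (rule wf_subset)
    show "wf (inv_image {(x, y). x < y} f)" by (rule wf_inv_image[OF wf])
    show "r - Id \<subseteq> inv_image {(x, y). x < y} f"
    proof
      fix e assume e: "e \<in> r - Id"
      obtain a b where ab: "e = (a, b)" by (cases e)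
      then have "a \<in> D" "b \<in> D" "f a \<le> f b" "a \<noteq> b" using e r by auto
      then show "e \<in> inv_image {(x, y). x < y} f" using ab inj unfolding inj_on_def
        by (auto simp: order_le_less)
    qed
  qed
  moreover have "Linear_order r"
    unfolding order_on_defs F
  proof (intro conjI)
    show "refl_on D r" using r unfolding refl_on_def by auto
    show "trans r" using r by (auto intro!: transI)
    show "antisym r" using r inj by (auto intro!: antisymI simp: inj_on_def)
    show "total_on D r" using r unfolding total_on_def by (metis linear)
    show "r \<subseteq> D \<times> D" using r by auto
  qed
  ultimately show "Well_order r" unfolding well_order_on_def by blast
  show "iso r (ord_on (f ` D)) f"
    unfolding iso_iff2 F Field_ord_on
  proof (intro conjI ballI)
    show "bij_betw f D (f ` D)" using inj by (simp add: bij_betw_def)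
    fix a b assume "a \<in> D" "b \<in> D"
    then show "(a, b) \<in> r \<longleftrightarrow> (f a, f b) \<in> ord_on (f ` D)" using r by (simp add: ord_on_def)
  qed
qed

lemma Well_order_ord_on: "Well_order (ord_on (X :: 'a::wellorder set))"
  by (rule order_embedding_into_wellorder(1)[of id X]) (auto simp: ord_on_def)

text \<open>
  The subbase of the order topology of \<open>Z\<close>.
\<close>

definition rays :: "'a::linorder set \<Rightarrow> 'a set set" where
  "rays Z = insert Z ((\<lambda>b. {x \<in> Z. x < b}) ` Z \<union> (\<lambda>b. {x \<in> Z. b < x}) ` Z)"

lemma order_topology_ord_on: "rel_order_topology (ord_on Z) = topology_generated_by (rays Z)"
  unfolding rel_order_topology_def rays_def by simp

lemma openin_ray: "U \<in> rays Z \<Longrightarrow> openin (rel_order_topology (ord_on Z)) U"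
  unfolding order_topology_ord_on by (rule topology_generated_by_Basis)

text \<open>
  The order topology of a subset is in general coarser than its subspace topology. The hypothesis
  says that \<open>X\<close> is closed: the part of \<open>X\<close> up to any bound \<open>b\<close>, if not empty, has a greatest element
  \<open>z\<close>. Then the trace of the ray above \<open>b\<close> is the ray of \<open>X\<close> above \<open>z\<close>. The trace of the ray
  below \<open>b\<close> is the ray below the least point of \<open>X\<close> that is at least \<open>b\<close>.
\<close>

lemma order_topology_of_closed_subset:
  fixes S :: "'a::wellorder set"
  assumes XS: "X \<subseteq> S"
    and closed: "\<And>b x. x \<in> X \<Longrightarrow> x \<le> b \<Longrightarrow> \<exists>z\<in>X. z \<le> b \<and> (\<forall>y\<in>X. y \<le> b \<longrightarrow> y \<le> z)"
  shows "subtopology (rel_order_topology (ord_on S)) X = rel_order_topology (ord_on X)"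
proof (rule topology_eq[THEN iffD2], rule allI, rule iffI)
  have topX: "openin (rel_order_topology (ord_on X)) X"
    by (rule openin_ray) (simp add: rays_def)
  have ray: "openin (rel_order_topology (ord_on X)) (U \<inter> X)" if U: "U \<in> rays S" for U
  proof -
    consider "U = S" | b where "b \<in> S" "U = {x \<in> S. x < b}" | b where "b \<in> S" "U = {x \<in> S. b < x}"
      using U unfolding rays_def by auto
    then show ?thesis
    proof cases
      case 1
      then show ?thesis using topX XS by (simp add: Int_absorb1)
    next
      case 2
      then have UX: "U \<inter> X = {x \<in> X. x < b}" using XS by auto
      show ?thesis
      proof (cases "\<exists>y\<in>X. b \<le> y")
        case True
        define y where "y = (LEAST y. y \<in> X \<and> b \<le> y)"
        have y: "y \<in> X \<and> b \<le> y" unfolding y_def using True by (metis (mono_tags, lifting) LeastI)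
        moreover have "x < b \<longleftrightarrow> x < y" if "x \<in> X" for x
        proof
          show "x < y" if "x < b" using y that by (meson order.strict_trans2)
          assume "x < y"
          then have "\<not> (x \<in> X \<and> b \<le> x)" unfolding y_def by (rule not_less_Least)
          then show "x < b" using that by simp
        qed
        ultimately have "U \<inter> X = {x \<in> X. x < y}" using UX by auto
        then show ?thesis using y by (intro openin_ray) (auto simp: rays_def)
      next
        case False
        then have "U \<inter> X = X" using UX by auto
        then show ?thesis using topX by simp
      qed
    next
      case 3
      then have UX: "U \<inter> X = {x \<in> X. b < x}" using XS by auto
      show ?thesis
      proof (cases "\<exists>x\<in>X. x \<le> b")
        case True
        then obtain z where z: "z \<in> X" "z \<le> b" "\<forall>y\<in>X. y \<le> b \<longrightarrow> y \<le> z" using closed by blast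
        have "b < x \<longleftrightarrow> z < x" if "x \<in> X" for x
          using z that by (metis leD leI order.strict_trans1)
        then have "U \<inter> X = {x \<in> X. z < x}" using UX by auto
        then show ?thesis using z(1) by (intro openin_ray) (auto simp: rays_def)
      next
        case False
        then have "U \<inter> X = X" using UX by auto
        then show ?thesis using topX by simp
      qed
    qed
  qed
  fix W
  assume "openin (subtopology (rel_order_topology (ord_on S)) X) W"
  then obtain V where V: "openin (rel_order_topology (ord_on S)) V" "W = V \<inter> X"
    by (auto simp: openin_subtopology)
  have "generate_topology_on (rays S) V" using V(1) unfolding order_topology_ord_on by (rule openin_topology_generated_by)
  then have "openin (rel_order_topology (ord_on X)) (V \<inter> X)"
  proof induction
    case (Int a b)
    then have "openin (rel_order_topology (ord_on X)) ((a \<inter> X) \<inter> (b \<inter> X))"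
      using Int by (intro openin_Int[of _ "a \<inter> X" "b \<inter> X"])
    moreover have "(a \<inter> X) \<inter> (b \<inter> X) = (a \<inter> b) \<inter> X" by auto
    ultimately show ?case by simp
  next
    case (UN K)
    then have "openin (rel_order_topology (ord_on X)) (\<Union>k\<in>K. k \<inter> X)"
      by (intro openin_Union) auto
    then show ?case by (simp only: Int_Union2)
  qed (use ray in auto)
  then show "openin (rel_order_topology (ord_on X)) W" using V by simp
next
  have "continuous_map (subtopology (rel_order_topology (ord_on S)) X) (rel_order_topology (ord_on X)) id"
    unfolding order_topology_ord_on[of X]
  proof (rule continuous_on_generated_topo)
    fix U assume "U \<in> rays X"
    then have "\<exists>V\<in>rays S. U = V \<inter> X"
    proof -
      consider "U = X" | b where "b \<in> X" "U = {x \<in> X. x < b}" | b where "b \<in> X" "U = {x \<in> X. b < x}"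
        using \<open>U \<in> rays X\<close> unfolding rays_def by auto
      then show ?thesis
      proof cases
        case 1
        then show ?thesis using XS by (intro bexI[of _ S]) (auto simp: rays_def)
      next
        case 2
        then show ?thesis using XS by (intro bexI[of _ "{x \<in> S. x < b}"]) (auto simp: rays_def)
      next
        case 3
        then show ?thesis using XS by (intro bexI[of _ "{x \<in> S. b < x}"]) (auto simp: rays_def)
      qed
    qed
    then obtain V where V: "V \<in> rays S" "U = V \<inter> X" by blast
    have "openin (rel_order_topology (ord_on S)) V" using V(1) by (rule openin_ray)
    then show "openin (subtopology (rel_order_topology (ord_on S)) X)
        (id -` U \<inter> topspace (subtopology (rel_order_topology (ord_on S)) X))"
      using V(2) XS by (auto simp: openin_subtopology)
  qed (auto simp: rays_def)
  moreover fix W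
  assume "openin (rel_order_topology (ord_on X)) W"
  ultimately have "openin (subtopology (rel_order_topology (ord_on S)) X)
      {x \<in> topspace (subtopology (rel_order_topology (ord_on S)) X). id x \<in> W}"
    unfolding continuous_map by blast
  moreover have "W \<subseteq> X" using openin_subset[OF \<open>openin (rel_order_topology (ord_on X)) W\<close>] by simp
  then have "{x \<in> topspace (subtopology (rel_order_topology (ord_on S)) X). id x \<in> W} = W"
    using XS by auto
  ultimately show "openin (subtopology (rel_order_topology (ord_on S)) X) W" by simp
qed

lemma order_homeomorphic_closed_image:
  fixes f :: "'b \<Rightarrow> 'a::wellorder"
  assumes inj: "inj_on f D" and r: "\<And>a b. (a, b) \<in> r \<longleftrightarrow> a \<in> D \<and> b \<in> D \<and> f a \<le> f b"
    and X: "f ` D \<subseteq> S"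
    and closed: "\<And>b x. x \<in> f ` D \<Longrightarrow> x \<le> b \<Longrightarrow> \<exists>z\<in>f ` D. z \<le> b \<and> (\<forall>y\<in>f ` D. y \<le> b \<longrightarrow> y \<le> z)"
  shows "order_homeomorphic (ord_on S) (f ` D) r"
proof -
  note emb = order_embedding_into_wellorder[OF inj r]
  define g where "g = inv_into D f"
  have F: "Field r = D" using r unfolding Field_def by auto
  have gf: "g (f x) = x" if "x \<in> D" for x using that inj by (simp add: g_def)
  have fg: "f (g y) = y" if "y \<in> f ` D" for y using that by (simp add: g_def f_inv_into_f)
  have isog: "iso (ord_on (f ` D)) r g"
    unfolding iso_iff2 F Field_ord_on
  proof (intro conjI ballI)
    show "bij_betw g (f ` D) D" unfolding g_def using inj by (simp add: bij_betw_inv_into inj_on_imp_bij_betw)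
    fix a b assume ab: "a \<in> f ` D" "b \<in> f ` D"
    then have "g a \<in> D" "g b \<in> D" unfolding g_def by (auto simp: inv_into_into)
    then show "(a, b) \<in> ord_on (f ` D) \<longleftrightarrow> (g a, g b) \<in> r"
      using ab r fg by (simp add: ord_on_def)
  qed
  have "homeomorphic_maps (rel_order_topology (ord_on (f ` D))) (rel_order_topology r) g f"
    unfolding homeomorphic_maps_def
    using iso_continuous_map[OF isog Well_order_ord_on emb(1)]
      iso_continuous_map[OF emb(2) emb(1) Well_order_ord_on] F gf fg by simp
  then have "homeomorphic_map (rel_order_topology (ord_on (f ` D))) (rel_order_topology r) g"
    by (meson homeomorphic_map_maps)
  moreover have "subtopology (rel_order_topology (ord_on S)) (f ` D) = rel_order_topology (ord_on (f ` D))"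
    using order_topology_of_closed_subset[OF X] closed by blast
  ultimately show ?thesis
    unfolding order_homeomorphic_def Restr_ord_on[OF X] using isog by auto
qed

section \<open>Closed copies of small ordinals\<close>

text \<open>
  Every element of \<open>A\<close> has only finitely many predecessors in \<open>A\<close>, so the increasing enumeration
  cannot stay below any of them.
\<close>

lemma enumerate_climbing_sequence:
  fixes A :: "'a::wellorder set"
  assumes A: "climbs A p"
  shows "range (enumerate A) = A"
proof
  have inf: "infinite A" using A unfolding climbs_def by blast
  show "range (enumerate A) \<subseteq> A" using enumerate_in_set[OF inf] by blast
  show "A \<subseteq> range (enumerate A)"
  proof (rule ccontr)
    assume "\<not> A \<subseteq> range (enumerate A)"
    then obtain a where a: "a \<in> A" "a \<notin> range (enumerate A)" by blast
    have "enumerate A k < a" for k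
    proof (induction k)
      case 0
      have "enumerate A 0 \<le> a" unfolding enumerate_0 using a(1) by (rule Least_le)
      then show ?case using a(2) by (metis order_le_less rangeI)
    next
      case (Suc k)
      then have "enumerate A (Suc k) \<le> a"
        unfolding enumerate_Suc''[OF inf] using a(1) by (intro Least_le) blast
      then show ?case using a(2) by (metis order_le_less rangeI)
    qed
    then have "range (enumerate A) \<subseteq> {x \<in> A. x \<le> a}"
      using enumerate_in_set[OF inf] by (auto simp: less_imp_le)
    moreover have "finite {x \<in> A. x \<le> a}" using A a(1) unfolding climbs_def by blast
    ultimately have "finite (range (enumerate A))" by (rule rev_finite_subset[rotated])
    then show False using range_inj_infinite[OF inj_enumerate[OF inf]] by blast
  qed
qed

lemma order_homeomorphic_omega_plus:
  fixes S :: "'a::wellorder set"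
  assumes A: "climbs A p" and Q: "\<And>q. q \<in> Q \<Longrightarrow> p < q" "finite Q" "card (insert p Q) = n"
    and S: "A \<union> insert p Q \<subseteq> S"
  shows "order_homeomorphic (ord_on S) (A \<union> insert p Q) (natLeq +\<^sub>o natLeq_on n)"
proof -
  have inf: "infinite A" using A unfolding climbs_def by blast
  define B where "B = insert p Q"
  have B: "finite B" "card B = n" "p \<in> B" "\<And>q. q \<in> B \<Longrightarrow> p \<le> q"
    using Q unfolding B_def by (auto simp: order_le_less)
  have AB: "a < b" if "a \<in> A" "b \<in> B" for a b
    using A B(4)[OF that(2)] that(1) unfolding climbs_def by (meson order.strict_trans2)
  define f where "f = case_sum (enumerate A) (enumerate B)"
  define D where "D = (UNIV :: nat set) <+> {..<n}"
  have bij: "bij_betw (enumerate B) {..<n} B" using finite_bij_enumerate[OF B(1)] B(2) by simp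
  have img: "f ` D = A \<union> B"
    unfolding f_def D_def Plus_def image_Un image_image
    using enumerate_climbing_sequence[OF A] bij by (simp add: bij_betw_def)
  have eA: "enumerate A k \<in> A" for k by (rule enumerate_in_set[OF inf])
  have eB: "enumerate B k \<in> B" if "k < n" for k using finite_enumerate_in_set[OF B(1)] that B(2) by simp
  have leB: "enumerate B j \<le> enumerate B k \<longleftrightarrow> j \<le> k" if "j < n" "k < n" for j k
    using finite_enumerate_mono_iff[OF B(1), of k j] that B(2) by (simp add: linorder_not_less[symmetric])
  have inj: "inj_on f D"
  proof (rule inj_onI)
    fix u v assume uv: "u \<in> D" "v \<in> D" "f u = f v"
    show "u = v"
    proof (cases u; cases v)
      fix j k assume "u = Inl j" "v = Inl k"
      then show ?thesis using uv(3) injD[OF inj_enumerate[OF inf], of j k] unfolding f_def by simp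
    next
      fix j k assume "u = Inl j" "v = Inr k"
      then show ?thesis using uv AB[OF eA[of j] eB[of k]] unfolding f_def D_def by auto
    next
      fix j k assume "u = Inr j" "v = Inl k"
      then show ?thesis using uv AB[OF eA[of k] eB[of j]] unfolding f_def D_def by auto
    next
      fix j k assume "u = Inr j" "v = Inr k"
      then show ?thesis using uv inj_onD[OF bij_betw_imp_inj_on[OF bij], of j k]
        unfolding f_def D_def by auto
    qed
  qed
  have r: "(u, v) \<in> natLeq +\<^sub>o natLeq_on n \<longleftrightarrow> u \<in> D \<and> v \<in> D \<and> f u \<le> f v" for u v
  proof (cases u; cases v)
    fix j k assume "u = Inl j" "v = Inl k"
    then show ?thesis unfolding osum_def D_def f_def natLeq_def using inf by auto
  next
    fix j k assume "u = Inl j" "v = Inr k"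
    then show ?thesis unfolding osum_def D_def f_def using AB[OF eA[of j] eB[of k]]
      by (auto simp: Field_natLeq Field_natLeq_on)
  next
    fix j k assume "u = Inr j" "v = Inl k"
    then show ?thesis unfolding osum_def D_def f_def using AB[OF eA[of k] eB[of j]]
      by auto
  next
    fix j k assume "u = Inr j" "v = Inr k"
    then show ?thesis unfolding osum_def D_def f_def using leB[of j k] by auto
  qed
  have "order_homeomorphic (ord_on S) (f ` D) (natLeq +\<^sub>o natLeq_on n)"
  proof (rule order_homeomorphic_closed_image[OF inj r])
    show "f ` D \<subseteq> S" using S unfolding img B_def .
    fix b x assume x: "x \<in> f ` D" "x \<le> b"
    \<comment> \<open>A bound below \<open>p\<close> leaves only finitely many points of \<open>A\<close>; for any other bound, the greatest
      point of the copy up to \<open>b\<close> is in the finite set \<open>B\<close>.\<close>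
    show "\<exists>z\<in>f ` D. z \<le> b \<and> (\<forall>y\<in>f ` D. y \<le> b \<longrightarrow> y \<le> z)"
    proof (cases "p \<le> b")
      case True
      define C where "C = {q \<in> B. q \<le> b}"
      have C: "finite C" "p \<in> C" unfolding C_def using B True by auto
      then have M: "Max C \<in> C" by (metis Max_in empty_iff)
      moreover have "y \<le> Max C" if "y \<in> f ` D" "y \<le> b" for y
      proof (cases "y \<in> B")
        case True
        then show ?thesis using C(1) that(2) unfolding C_def by (intro Max_ge) auto
      next
        case False
        then have "y \<in> A" using that(1) img by blast
        then show ?thesis using AB M unfolding C_def by (auto simp: less_imp_le)
      qed
      ultimately show ?thesis unfolding img C_def by blast
    next
      case False
      define C where "C = {a \<in> A. a \<le> b}"
      have *: "y \<in> C" if "y \<in> f ` D" "y \<le> b" for y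
      proof -
        have "y \<notin> B" using that(2) False B(4) by (meson order_trans)
        then show ?thesis using that img unfolding C_def by blast
      qed
      have C: "finite C" using A False unfolding C_def climbs_def by simp
      have "Max C \<in> C" using C * x by (metis Max_in empty_iff)
      then show ?thesis unfolding img using * C unfolding C_def img by (metis (mono_tags, lifting) Max_ge UnI1 mem_Collect_eq)
    qed
  qed
  then show ?thesis unfolding img B_def .
qed

lemma order_homeomorphic_finite:
  fixes S :: "'a::wellorder set"
  assumes X: "finite X" "X \<subseteq> S"
  shows "order_homeomorphic (ord_on S) X (natLeq_on (card X))"
proof -
  have bij: "bij_betw (enumerate X) {..<card X} X" using finite_bij_enumerate[OF X(1)] .
  then have inj: "inj_on (enumerate X) {..<card X}" and img: "enumerate X ` {..<card X} = X"
    by (auto simp: bij_betw_def)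
  have r: "(j, k) \<in> natLeq_on (card X) \<longleftrightarrow>
      j \<in> {..<card X} \<and> k \<in> {..<card X} \<and> enumerate X j \<le> enumerate X k" for j k
    using finite_enumerate_mono_iff[OF X(1), of k j] by (auto simp: linorder_not_less[symmetric])
  have "order_homeomorphic (ord_on S) (enumerate X ` {..<card X}) (natLeq_on (card X))"
  proof (rule order_homeomorphic_closed_image[OF inj r])
    show "enumerate X ` {..<card X} \<subseteq> S" using X(2) img by simp
    fix b x assume x: "x \<in> enumerate X ` {..<card X}" "x \<le> b"
    define C where "C = {y \<in> X. y \<le> b}"
    have C: "finite C" "C \<noteq> {}" using X(1) x img unfolding C_def by auto
    have "Max C \<in> C" using C by (rule Max_in)
    moreover have "y \<le> Max C" if "y \<in> X" "y \<le> b" for y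
      using that C(1) unfolding C_def by (intro Max_ge) auto
    ultimately show "\<exists>z\<in>enumerate X ` {..<card X}. z \<le> b \<and>
        (\<forall>y\<in>enumerate X ` {..<card X}. y \<le> b \<longrightarrow> y \<le> z)"
      unfolding img C_def by blast
  qed
  then show ?thesis unfolding img .
qed

section \<open>The ordinals below \<open>\<omega>\<^sup>3\<close>\<close>

text \<open>
  \<open>Ord k i x\<close> is the ordinal \<open>\<omega>\<^sup>2 \<cdot> k + \<omega> \<cdot> i + x\<close>.
\<close>

datatype ord3 = Ord nat nat nat

instance ord3 :: countable by countable_datatype

instantiation ord3 :: wellorder
begin

fun less_eq_ord3 :: "ord3 \<Rightarrow> ord3 \<Rightarrow> bool" where
  "less_eq_ord3 (Ord k i x) (Ord k' i' x') \<longleftrightarrow> k < k' \<or> k = k' \<and> (i < i' \<or> i = i' \<and> x \<le> x')"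

fun less_ord3 :: "ord3 \<Rightarrow> ord3 \<Rightarrow> bool" where
  "less_ord3 (Ord k i x) (Ord k' i' x') \<longleftrightarrow> k < k' \<or> k = k' \<and> (i < i' \<or> i = i' \<and> x < x')"

instance
proof
  fix a b c :: ord3
  show "a < b \<longleftrightarrow> a \<le> b \<and> \<not> b \<le> a" by (cases a; cases b) auto
  show "a \<le> a" by (cases a) auto
  show "a \<le> b \<Longrightarrow> b \<le> c \<Longrightarrow> a \<le> c" by (cases a; cases b; cases c) auto
  show "a \<le> b \<Longrightarrow> b \<le> a \<Longrightarrow> a = b" by (cases a; cases b) auto
  show "a \<le> b \<or> b \<le> a" by (cases a; cases b) auto
next
  fix Q :: "ord3 \<Rightarrow> bool" and a :: ord3
  assume step: "\<And>a. (\<And>b. b < a \<Longrightarrow> Q b) \<Longrightarrow> Q a"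
  have "wf (inv_image (less_than <*lex*> less_than <*lex*> less_than)
      (\<lambda>a. case a of Ord k i x \<Rightarrow> (k, i, x)))" (is "wf ?r")
    by (intro wf_inv_image wf_lex_prod wf_less_than)
  then show "Q a"
  proof (induction a rule: wf_induct_rule)
    case (less a)
    show ?case
    proof (rule step)
      fix b assume "b < a"
      then have "(b, a) \<in> ?r" by (cases a; cases b) (auto simp: in_inv_image)
      then show "Q b" by (rule less)
    qed
  qed
qed

end

lemma climbs_first_limits: "climbs (range (Ord k i)) (Ord k (Suc i) 0)"
proof (rule climbs_strict_mono)
  show "strict_mono (Ord k i)" by (rule strict_monoI) simp
  show "\<exists>x. y < Ord k i x" if y: "y < Ord k (Suc i) 0" for y
  proof (cases y)
    case (Ord k' i' x')
    then have "y < Ord k i (Suc x')" using y by auto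
    then show ?thesis by blast
  qed
qed simp

lemma climbs_second_limits: "climbs (range (\<lambda>i. Ord k (Suc i) 0)) (Ord (Suc k) 0 0)"
proof (rule climbs_strict_mono)
  show "strict_mono (\<lambda>i. Ord k (Suc i) 0)" by (rule strict_monoI) simp
  show "\<exists>i. y < Ord k (Suc i) 0" if y: "y < Ord (Suc k) 0 0" for y
  proof (cases y)
    case (Ord k' i' x')
    then have "y < Ord k (Suc i') 0" using y by auto
    then show ?thesis by blast
  qed
qed simp

lemma ord3_colouring_impossible:
  assumes n: "n \<ge> 3" and no: "no_red_copy E {..Ord n (n\<^sup>2 - 4) 0} (n - 1)"
  shows False
proof -
  have n4: "n\<^sup>2 \<ge> 9" using n power_mono[of 3 n 2] by simp
  define S where "S = {..Ord n (n\<^sup>2 - 4) 0}"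
  define P where "P = (\<lambda>k. Ord (Suc k) 0 0) ` {..<n}"
  define R where "R = (\<lambda>i. Ord n (Suc i) 0) ` {..<n\<^sup>2 - 5}"
  have lim1: "limit_from_below S (Ord k (Suc i) 0)" if "Ord k (Suc i) 0 \<in> S" for k i
    unfolding limit_from_below_def
  proof (intro exI conjI)
    show "climbs (range (Ord k i)) (Ord k (Suc i) 0)" by (rule climbs_first_limits)
    show "range (Ord k i) \<subseteq> S" using that unfolding S_def by auto
  qed
  interpret no_red_copy E S "n - 1" using no unfolding S_def .
  interpret large_space E S "n - 1" P R
  proof
    show "2 \<le> n - 1" using n by simp
    show "P \<subseteq> S" unfolding P_def S_def using n4 by auto
    show "card P = n - 1 + 1" unfolding P_def using n by (simp add: card_image inj_on_def)
    show "limit_from_below {r \<in> S. limit_from_below S r} s" if s: "s \<in> P" for s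
    proof -
      obtain k where k: "k < n" "s = Ord (Suc k) 0 0" using s unfolding P_def by blast
      have "Ord k (Suc i) 0 \<in> S" for i using k(1) unfolding S_def by simp
      then have "range (\<lambda>i. Ord k (Suc i) 0) \<subseteq> {r \<in> S. limit_from_below S r}" using lim1 by blast
      then show ?thesis unfolding limit_from_below_def k(2) using climbs_second_limits by blast
    qed
    show RS: "R \<subseteq> S" unfolding R_def S_def by auto
    show "finite R" unfolding R_def by simp
    show "(n - 1)\<^sup>2 + 2 * (n - 1) \<le> card R + 4"
    proof -
      have "card R = n\<^sup>2 - 5" unfolding R_def by (simp add: card_image inj_on_def)
      moreover have "n\<^sup>2 = (n - 1)\<^sup>2 + 2 * (n - 1) + 1"
      proof -
        obtain j where "n = Suc j" using n by (cases n) auto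
        then show ?thesis by (simp add: power2_eq_square)
      qed
      ultimately show ?thesis using n4 by simp
    qed
    show "limit_from_below S r" if "r \<in> R" for r using that lim1 RS unfolding R_def by blast
    show "infinite {x \<in> S. r < x}" if r: "r \<in> R" for r
    proof -
      obtain i where i: "i < n\<^sup>2 - 5" "r = Ord n (Suc i) 0" using r unfolding R_def by blast
      have "range (\<lambda>x. Ord n (Suc i) (Suc x)) \<subseteq> {x \<in> S. r < x}"
        using i unfolding S_def by auto
      moreover have "infinite (range (\<lambda>x. Ord n (Suc i) (Suc x)))"
        by (rule range_inj_infinite) (simp add: inj_def)
      ultimately show ?thesis using finite_subset by blast
    qed
    show "s < r" if "s \<in> P" "r \<in> R" for s r using that unfolding P_def R_def by auto
  qed
  show False by (rule colouring_impossible)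
qed

lemma mem_osum: "(u, v) \<in> r +\<^sub>o s \<longleftrightarrow> osum_le r s u v"
  unfolding osum_def by simp

lemma Plus_iff: "Inl a \<in> X <+> Y \<longleftrightarrow> a \<in> X" "Inr b \<in> X <+> Y \<longleftrightarrow> b \<in> Y"
  by auto

lemma Field_osum: "Field (r +\<^sub>o s) = Field r <+> Field s"
proof (rule set_eqI)
  fix u
  show "u \<in> Field (r +\<^sub>o s) \<longleftrightarrow> u \<in> Field r <+> Field s"
  proof
    assume "u \<in> Field (r +\<^sub>o s)"
    then obtain v where "osum_le r s u v \<or> osum_le r s v u" unfolding osum_def Field_def by blast
    then show "u \<in> Field r <+> Field s" by (cases u; cases v) (auto simp: Field_def)
  next
    assume "u \<in> Field r <+> Field s"
    then obtain v where "osum_le r s u v \<or> osum_le r s v u"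
    proof (rule PlusE)
      fix x assume *: "\<And>v. osum_le r s u v \<or> osum_le r s v u \<Longrightarrow> thesis" "x \<in> Field r" "u = Inl x"
      from this(2) obtain y where "(x, y) \<in> r \<or> (y, x) \<in> r" unfolding Field_def by blast
      then show thesis using *(1)[of "Inl y"] *(3) by auto
    next
      fix x assume *: "\<And>v. osum_le r s u v \<or> osum_le r s v u \<Longrightarrow> thesis" "x \<in> Field s" "u = Inr x"
      from this(2) obtain y where "(x, y) \<in> s \<or> (y, x) \<in> s" unfolding Field_def by blast
      then show thesis using *(1)[of "Inr y"] *(3) by auto
    qed
    then show "u \<in> Field (r +\<^sub>o s)" unfolding osum_def Field_def by blast
  qed
qed

lemma Field_oprod:
  assumes "Refl r" "Refl s"
  shows "Field (r *\<^sub>o s) = Field r \<times> Field s"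
proof
  show "Field (r *\<^sub>o s) \<subseteq> Field r \<times> Field s" unfolding oprod_def Field_def[of "Collect _"] by auto
  show "Field r \<times> Field s \<subseteq> Field (r *\<^sub>o s)"
  proof
    fix u assume u: "u \<in> Field r \<times> Field s"
    then have "(u, u) \<in> r *\<^sub>o s" unfolding oprod_def using assms by (auto simp: refl_on_def)
    then show "u \<in> Field (r *\<^sub>o s)" by (rule FieldI1)
  qed
qed

lemma ordIso_ord3:
  "(natLeq *\<^sub>o natLeq) *\<^sub>o natLeq_on n +\<^sub>o natLeq *\<^sub>o natLeq_on N +\<^sub>o natLeq_on 1
    =o ord_on {..Ord n N 0}"
proof -
  let ?r = "(natLeq *\<^sub>o natLeq) *\<^sub>o natLeq_on n +\<^sub>o natLeq *\<^sub>o natLeq_on N +\<^sub>o natLeq_on 1"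
  define f :: "(((nat \<times> nat) \<times> nat) + (nat \<times> nat)) + nat \<Rightarrow> ord3" where
    "f = case_sum (case_sum (\<lambda>((x, i), k). Ord k i x) (\<lambda>(x, i). Ord n i x)) (\<lambda>_. Ord n N 0)"
  define D where "D = (((UNIV :: (nat \<times> nat) set) \<times> {..<n}) <+> ((UNIV :: nat set) \<times> {..<N})) <+> {..<1 :: nat}"
  have refl: "Refl natLeq" "Refl (natLeq_on k)" for k
    using natLeq_Well_order natLeq_on_Well_order[of k] by (simp_all add: order_on_defs)
  have natLeq: "(a, b) \<in> natLeq \<longleftrightarrow> a \<le> b" for a b unfolding natLeq_def by simp
  have refl2: "Refl (natLeq *\<^sub>o natLeq)"
    unfolding refl_on_def Field_oprod[OF refl(1) refl(1)] by (auto simp: oprod_def Field_natLeq natLeq)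
  have F2: "Field (natLeq *\<^sub>o natLeq) = UNIV"
    unfolding Field_oprod[OF refl(1) refl(1)] Field_natLeq by simp
  have F3: "Field ((natLeq *\<^sub>o natLeq) *\<^sub>o natLeq_on n) = UNIV \<times> {..<n}"
    unfolding Field_oprod[OF refl2 refl(2)] F2 Field_natLeq_on by auto
  have F4: "Field (natLeq *\<^sub>o natLeq_on N) = UNIV \<times> {..<N}"
    unfolding Field_oprod[OF refl] Field_natLeq Field_natLeq_on by auto
  have inj: "inj_on f D"
    unfolding inj_on_def D_def f_def by auto
  have r2: "((x, i), (y, j)) \<in> natLeq *\<^sub>o natLeq \<longleftrightarrow> i < j \<or> i = j \<and> x \<le> y" for x i y j
    unfolding oprod_def by (auto simp: Field_natLeq natLeq)
  have r3: "(((x, i), k), ((y, j), l)) \<in> (natLeq *\<^sub>o natLeq) *\<^sub>o natLeq_on n \<longleftrightarrow>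
      k < n \<and> l < n \<and> Ord k i x \<le> Ord l j y" for x i k y j l
    unfolding oprod_def[of "natLeq *\<^sub>o natLeq"] F2 Field_natLeq_on using r2[of x i y j] by auto
  have r4: "((x, i), (y, j)) \<in> natLeq *\<^sub>o natLeq_on N \<longleftrightarrow>
      i < N \<and> j < N \<and> (i < j \<or> i = j \<and> x \<le> y)" for x i y j
    unfolding oprod_def by (auto simp: Field_natLeq Field_natLeq_on natLeq)
  have r: "(u, v) \<in> ?r \<longleftrightarrow> u \<in> D \<and> v \<in> D \<and> f u \<le> f v" for u v
  proof -
    have cases: "(\<exists>x i k. w = Inl (Inl ((x, i), k))) \<or> (\<exists>x i. w = Inl (Inr (x, i))) \<or> (\<exists>z. w = Inr z)"
      for w :: "(((nat \<times> nat) \<times> nat) + (nat \<times> nat)) + nat"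
    proof (cases w)
      case w: (Inl a)
      show ?thesis
      proof (cases a)
        case (Inl b)
        then show ?thesis using w by (cases b) auto
      next
        case (Inr b)
        then show ?thesis using w by (cases b) auto
      qed
    qed auto
    show ?thesis
      using cases[of u] cases[of v]
      by (elim disjE exE; simp only: mem_osum osum_le.simps r3 r4 Field_osum F3 F4 Field_natLeq_on;
          simp only: D_def f_def Plus_iff; auto)
  qed
  have img: "f ` D = {..Ord n N 0}"
  proof
    show "f ` D \<subseteq> {..Ord n N 0}" unfolding D_def f_def by auto
    show "{..Ord n N 0} \<subseteq> f ` D"
    proof
      fix w assume w: "w \<in> {..Ord n N 0}"
      obtain k i x where wk: "w = Ord k i x" by (cases w)
      then consider "k < n" | "k = n" "i < N" | "k = n" "i = N" "x = 0" using w by auto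
      then show "w \<in> f ` D"
      proof cases
        case 1
        then show ?thesis by (intro image_eqI[of _ _ "Inl (Inl ((x, i), k))"]) (auto simp: wk f_def D_def)
      next
        case 2
        then show ?thesis by (intro image_eqI[of _ _ "Inl (Inr (x, i))"]) (auto simp: wk f_def D_def)
      next
        case 3
        then show ?thesis by (intro image_eqI[of _ _ "Inr 0"]) (auto simp: wk f_def D_def)
      qed
    qed
  qed
  show ?thesis
    using order_embedding_into_wellorder[OF inj r] Well_order_ord_on unfolding img ordIso_def by blast
qed

section \<open>The bound for the closed Ramsey number\<close>

lemma closed_arrow_ord3:
  assumes n: "n \<ge> 3"
  shows "closed_arrow (ord_on {..Ord n (n\<^sup>2 - 4) 0}) (natLeq +\<^sub>o natLeq_on n) (natLeq_on 3)"
  unfolding closed_arrow_def Field_ord_on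
proof (rule ballI, rule ccontr)
  define S where "S = {..Ord n (n\<^sup>2 - 4) 0}"
  fix c assume "c \<in> [{..Ord n (n\<^sup>2 - 4) 0}]\<^bsup>2\<^esup> \<rightarrow> {0, 1::nat}"
  then have c: "c \<in> [S]\<^bsup>2\<^esup> \<rightarrow> {0, 1::nat}" unfolding S_def .
  assume "\<not> (\<exists>X\<subseteq>{..Ord n (n\<^sup>2 - 4) 0}.
      [X]\<^bsup>2\<^esup> \<subseteq> c -` {0} \<and> order_homeomorphic (ord_on {..Ord n (n\<^sup>2 - 4) 0}) X (natLeq +\<^sub>o natLeq_on n) \<or>
      [X]\<^bsup>2\<^esup> \<subseteq> c -` {1} \<and> order_homeomorphic (ord_on {..Ord n (n\<^sup>2 - 4) 0}) X (natLeq_on 3))"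
  then have no: "\<And>X. X \<subseteq> S \<Longrightarrow> [X]\<^bsup>2\<^esup> \<subseteq> c -` {0} \<Longrightarrow>
      order_homeomorphic (ord_on S) X (natLeq +\<^sub>o natLeq_on n) \<Longrightarrow> False"
    "\<And>X. X \<subseteq> S \<Longrightarrow> [X]\<^bsup>2\<^esup> \<subseteq> c -` {1} \<Longrightarrow> order_homeomorphic (ord_on S) X (natLeq_on 3) \<Longrightarrow> False"
    unfolding S_def by blast+
  define E where "E x y \<longleftrightarrow> x \<in> S \<and> y \<in> S \<and> x \<noteq> y \<and> c {x, y} = 1" for x y
  have "no_red_copy E S (n - 1)"
  proof
    show "E x y \<Longrightarrow> E y x" for x y unfolding E_def by (auto simp: insert_commute)
    show "\<not> E x x" for x unfolding E_def by blast
    show False if e: "E x y" "E y z" "E x z" for x y z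
    proof (rule no(2))
      show sub: "{x, y, z} \<subseteq> S" using e unfolding E_def by blast
      show "[{x, y, z}]\<^bsup>2\<^esup> \<subseteq> c -` {1}"
      proof
        fix e' assume "e' \<in> [{x, y, z}]\<^bsup>2\<^esup>"
        then have "e' \<subseteq> {x, y, z}" "card e' = 2" unfolding nsets_def by auto
        then obtain u v where "e' = {u, v}" "u \<noteq> v" "u \<in> {x, y, z}" "v \<in> {x, y, z}"
          by (auto simp: card_2_iff)
        then show "e' \<in> c -` {1}" using e unfolding E_def by (auto simp: insert_commute)
      qed
      have "card {x, y, z} = 3" using e unfolding E_def by simp
      then show "order_homeomorphic (ord_on S) {x, y, z} (natLeq_on 3)"
        using order_homeomorphic_finite[OF _ sub] by simp
    qed
    show "1 \<le> n - 1" using n by simp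
    fix A p Q
    assume A: "climbs A p" and Q: "\<And>q. q \<in> Q \<Longrightarrow> p < q" "card Q = n - 1"
      and S: "A \<union> insert p Q \<subseteq> S" and ind: "independent_in E (A \<union> insert p Q)"
    have fin: "finite Q" using Q(2) n card.infinite by fastforce
    have "p \<notin> Q" using Q(1) by blast
    then have card: "card (insert p Q) = n" using fin Q(2) n by simp
    show False
    proof (rule no(1)[OF S])
      show "order_homeomorphic (ord_on S) (A \<union> insert p Q) (natLeq +\<^sub>o natLeq_on n)"
        using order_homeomorphic_omega_plus[OF A Q(1) fin card S] .
      show "[A \<union> insert p Q]\<^bsup>2\<^esup> \<subseteq> c -` {0}"
      proof
        fix e assume "e \<in> [A \<union> insert p Q]\<^bsup>2\<^esup>"
        then have e: "e \<subseteq> A \<union> insert p Q" "card e = 2" "finite e" unfolding nsets_def by auto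
        then obtain u v where uv: "e = {u, v}" "u \<noteq> v" by (auto simp: card_2_iff)
        then have "u \<in> A \<union> insert p Q" "v \<in> A \<union> insert p Q" using e(1) by auto
        then have "\<not> E u v" using bspec[OF bspec[OF ind[unfolded independent_in_def]]] by blast
        moreover have "e \<in> [S]\<^bsup>2\<^esup>" using e S unfolding nsets_def by blast
        then have "c e \<in> {0, 1}" using c by blast
        ultimately show "e \<in> c -` {0}" using uv e(1) S unfolding E_def by auto
      qed
    qed
  qed
  then show False using ord3_colouring_impossible[OF n] unfolding S_def by blast
qed

text \<open>
  A least ordinal with the arrow property exists among the well-orders of the natural numbers, because
  a countable witness has an isomorphic copy there.
\<close>

lemma closed_ramsey_number_exists:
  fixes r :: "'c::countable rel"
  assumes r: "Well_order r" "closed_arrow r \<alpha> \<beta>"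
  shows "\<exists>\<gamma> :: nat rel. is_closed_ramsey_number \<alpha> \<beta> \<gamma> \<and> \<gamma> \<le>o r"
proof -
  define M where "M = {\<gamma> :: nat rel. Well_order \<gamma> \<and> closed_arrow \<gamma> \<alpha> \<beta>}"
  have iso: "r =o dir_image r to_nat" using r(1) by (rule dir_image_ordIso) (simp add: inj_on_def)
  then have M: "dir_image r to_nat \<in> M"
    unfolding M_def using closed_arrow_ordIso[OF iso r(2)] by (auto simp: ordIso_def)
  obtain \<gamma> where \<gamma>: "\<gamma> \<in> M" "\<And>\<gamma>' :: nat rel. \<gamma>' <o \<gamma> \<Longrightarrow> \<gamma>' \<notin> M"
    using wfE_min[OF wf_ordLess M] by metis
  have least: "\<gamma> \<le>o \<gamma>'" if "\<gamma>' \<in> M" for \<gamma>'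
    using \<gamma> that not_ordLess_iff_ordLeq[of \<gamma> \<gamma>'] unfolding M_def by blast
  have "is_closed_ramsey_number \<alpha> \<beta> \<gamma>"
    using \<gamma>(1) least unfolding is_closed_ramsey_number_def M_def by blast
  moreover have "\<gamma> \<le>o r" using least[OF M] ordIso_symmetric[OF iso] by (rule ordLeq_ordIso_trans)
  ultimately show ?thesis by blast
qed

theorem theorem3:
  fixes n :: nat
  assumes "n \<ge> 3"
  shows "\<exists>\<gamma> :: nat rel.
           is_closed_ramsey_number (natLeq +\<^sub>o natLeq_on n) (natLeq_on 3) \<gamma> \<and>
           \<gamma> \<le>o (natLeq *\<^sub>o natLeq) *\<^sub>o natLeq_on n +\<^sub>o natLeq *\<^sub>o natLeq_on (n\<^sup>2 - 4)
                 +\<^sub>o natLeq_on 1"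
  using closed_ramsey_number_exists[OF Well_order_ord_on closed_arrow_ord3[OF assms]]
    ordIso_symmetric[OF ordIso_ord3] ordLeq_ordIso_trans by blast

end
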